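(* Suppose that Assumption A holds. Then there is $\delta_2>0$ such that whenever $\delta(z,\lambda)\le\delta_2$, Procedure ID0 applied at $(z,\lambda)$ terminates with $\mathcal A_+=\mathcal B_+$ and $\mathcal A_0=\mathcal B_0$.
   Context: **Problem.** $\min_z\phi(z)$ subject to $g(z)\le 0$, with $\phi:\mathbb R^n\to\mathbb R$, $g:\mathbb R^n\to\mathbb R^m$ twice Lipschitz continuously differentiable. Lagrangian: $\mathcal L(z,\lambda)=\phi(z)+\lambda^Tg(z)$; $\mathcal L_z,\mathcal L_{zz}$ are its gradient and Hessian in $z$. KKT conditions at $z^*$: there is $\lambda^*\in\mathbb R^m$ with $\mathcal L_z(z^*,\lambda^* )=0$, $g(z^* )\le0$, $\lambda^*\ge0$, $(\lambda^* )^Tg(z^* )=0$. $\mathcal S_\lambda$ is the set of all $\lambda^*$ satisfying the KKT conditions at the fixed point $z^*$, and $\mathcal S=\{z^*\}\times\mathcal S_\lambda$. $\mathcal B=\{i: g_i(z^* )=0\}$ (active indices); $\mathcal B_+=\{i\in\mathcal B:\lambda^*_i>0\text{ for some }\lambda^*\in\mathcal S_\lambda\}$ (strongly active); $\mathcal B_0=\mathcal B\setminus\mathcal B_+$ (weakly active). **Assumption A.** (i) The KKT conditions hold at $z^*$. (ii) MFCQ: there is $\bar y\in\mathbb R^n$ with $\nabla g_i(z^* )^T\bar y<0$ for all $i\in\mathcal B$. (iii) There is $\alpha>0$ such that $w^T\mathcal L_{zz}(z^*,\lambda^* )w\ge\alpha\|w\|^2$ for all $\lambda^*\in\mathcal S_\lambda$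 and all $w$ with $\nabla g_i(z^* )^Tw=0$ for $i\in\mathcal B_+$ and $\nabla g_i(z^* )^Tw\le0$ for $i\in\mathcal B_0$. (iv) $\phi$ and $g$ are twice Lipschitz continuously differentiable in a neighborhood of $z^*$. **Distances.** $\|\cdot\|$ is the Euclidean norm, $\delta(z,\lambda)=\operatorname{dist}((z,\lambda),\mathcal S)$, and $\eta(z,\lambda)=\left\|\begin{pmatrix}\mathcal L_z(z,\lambda)\\ \min(\lambda,-g(z))\end{pmatrix}\right\|$ with the min taken componentwise. $\mathcal A(z,\lambda)=\{i: g_i(z)\ge-\eta(z,\lambda)^\tau\}$. **Procedure ID0** at $(z,\lambda)$, with given constants $0<\hat\tau<\tau<1$. Set $\hat{\mathcal A}=\hat{\mathcal A}_{\rm init}=\mathcal A(z,\lambda)\setminus\{i:\lambda_i\ge\eta(z,\lambda)^{\hat\tau}\}$. Repeat: solve the linear program $$\max_{\tilde\lambda}\sum_{i\in\hat{\mathcal A}}\tilde\lambda_i\ \text{ s.t. }\ -\eta(z,\lambda)^\tau e\le\nabla\phi(z)+\sum_{i\in\mathcal A(z,\lambda)}\tilde\lambda_i\nabla g_i(z)\le\eta(z,\lambda)^\tau e,\ \tilde\lambda_i\ge0\ (i\in\mathcal A(z,\lambda)),\ \tilde\lambda_i=0\text{ otherwise}$$ ($e$ is the vector of ones, inequalities componentwise) to find $\tilde\lambda$; set $\mathcal C=\{i\in\hat{\mathcal A}:\tilde\lambda_i\ge\eta(z,\lambda)^{\hat\tau}\}$; if $\mathcal C=\emptyset$, stop with $\mathcal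 A_0=\hat{\mathcal A}$, $\mathcal A_+=\mathcal A(z,\lambda)\setminus\hat{\mathcal A}$; otherwise replace $\hat{\mathcal A}$ by $\hat{\mathcal A}\setminus\mathcal C$, and if it is now empty stop with $\mathcal A_0=\emptyset$, $\mathcal A_+=\mathcal A(z,\lambda)$.
   Formalization: Points (z,λ) of S itself are excluded when B_0 is nonempty: there η=0, so ID0 starts with an empty set and returns A_0=∅≠B_0 (e.g. φ=z²/2, g=z at (0,0)); all other points with δ(z,λ)≤δ_2 are covered. *)

theory Defs
  imports "HOL-Analysis.Analysis"
begin

definition grad :: "(real^'n \<Rightarrow> real) \<Rightarrow> real^'n \<Rightarrow> real^'n" where
  "grad f x = (THE D. GDERIV f x :> D)"

definition hess :: "(real^'n \<Rightarrow> real) \<Rightarrow> real^'n \<Rightarrow> real^'n^'n" where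
  "hess f x = jacobian (grad f) (at x)"

definition twice_lipschitz_differentiable_on ::
    "(real^'n \<Rightarrow> real) \<Rightarrow> (real^'n) set \<Rightarrow> bool" where
  "twice_lipschitz_differentiable_on f U \<longleftrightarrow>
     (\<forall>x\<in>U. f differentiable at x) \<and>
     (\<forall>x\<in>U. grad f differentiable at x) \<and>
     (\<exists>L. L-lipschitz_on U (hess f))"

definition grad_constr :: "(real^'n \<Rightarrow> real^'m) \<Rightarrow> 'm \<Rightarrow> real^'n \<Rightarrow> real^'n" where
  "grad_constr g i z = grad (\<lambda>y. g y $ i) z"

definition lagr :: "(real^'n \<Rightarrow> real) \<Rightarrow> (real^'n \<Rightarrow> real^'m) \<Rightarrow> real^'n \<Rightarrow> real^'m \<Rightarrow> real" where
  "lagr \<phi> g z lam = \<phi> z + lam \<bullet> g z"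

definition lagr_z :: "(real^'n \<Rightarrow> real) \<Rightarrow> (real^'n \<Rightarrow> real^'m) \<Rightarrow> real^'n \<Rightarrow> real^'m \<Rightarrow> real^'n" where
  "lagr_z \<phi> g z lam = grad (\<lambda>y. lagr \<phi> g y lam) z"

definition lagr_zz :: "(real^'n \<Rightarrow> real) \<Rightarrow> (real^'n \<Rightarrow> real^'m) \<Rightarrow> real^'n \<Rightarrow> real^'m \<Rightarrow> real^'n^'n" where
  "lagr_zz \<phi> g z lam = hess (\<lambda>y. lagr \<phi> g y lam) z"

text \<open>The set \<open>S\<^sub>\<lambda>\<close> of multipliers satisfying the KKT conditions at \<open>zs\<close>, and
  \<open>S = {zs} \<times> S\<^sub>\<lambda>\<close>. The order on \<open>real^'m\<close> is componentwise.\<close>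

definition kkt_multipliers :: "(real^'n \<Rightarrow> real) \<Rightarrow> (real^'n \<Rightarrow> real^'m) \<Rightarrow> real^'n \<Rightarrow> (real^'m) set" where
  "kkt_multipliers \<phi> g zs =
     {lam. lagr_z \<phi> g zs lam = 0 \<and> g zs \<le> 0 \<and> 0 \<le> lam \<and> lam \<bullet> g zs = 0}"

definition kkt_set :: "(real^'n \<Rightarrow> real) \<Rightarrow> (real^'n \<Rightarrow> real^'m) \<Rightarrow> real^'n \<Rightarrow> ((real^'n) \<times> (real^'m)) set" where
  "kkt_set \<phi> g zs = {zs} \<times> kkt_multipliers \<phi> g zs"

definition active :: "(real^'n \<Rightarrow> real^'m) \<Rightarrow> real^'n \<Rightarrow> 'm set" where
  "active g zs = {i. g zs $ i = 0}"

definition strongly_active :: "(real^'n \<Rightarrow> real) \<Rightarrow> (real^'n \<Rightarrow> real^'m) \<Rightarrow> real^'n \<Rightarrow> 'm set" where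
  "strongly_active \<phi> g zs = {i \<in> active g zs. \<exists>lam \<in> kkt_multipliers \<phi> g zs. lam $ i > 0}"

definition weakly_active :: "(real^'n \<Rightarrow> real) \<Rightarrow> (real^'n \<Rightarrow> real^'m) \<Rightarrow> real^'n \<Rightarrow> 'm set" where
  "weakly_active \<phi> g zs = active g zs - strongly_active \<phi> g zs"

definition mfcq :: "(real^'n \<Rightarrow> real^'m) \<Rightarrow> real^'n \<Rightarrow> bool" where
  "mfcq g zs \<longleftrightarrow> (\<exists>y. \<forall>i \<in> active g zs. grad_constr g i zs \<bullet> y < 0)"

definition second_order_sufficient :: "(real^'n \<Rightarrow> real) \<Rightarrow> (real^'n \<Rightarrow> real^'m) \<Rightarrow> real^'n \<Rightarrow> bool" where
  "second_order_sufficient \<phi> g zs \<longleftrightarrow>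
     (\<exists>\<alpha>>0. \<forall>lam \<in> kkt_multipliers \<phi> g zs. \<forall>w.
        (\<forall>i \<in> strongly_active \<phi> g zs. grad_constr g i zs \<bullet> w = 0) \<and>
        (\<forall>i \<in> weakly_active \<phi> g zs. grad_constr g i zs \<bullet> w \<le> 0) \<longrightarrow>
        w \<bullet> (lagr_zz \<phi> g zs lam *v w) \<ge> \<alpha> * (norm w)\<^sup>2)"

definition standing_assumptions :: "(real^'n \<Rightarrow> real) \<Rightarrow> (real^'n \<Rightarrow> real^'m) \<Rightarrow> real^'n \<Rightarrow> bool" where
  "standing_assumptions \<phi> g zs \<longleftrightarrow>
     kkt_multipliers \<phi> g zs \<noteq> {} \<and>
     mfcq g zs \<and>
     second_order_sufficient \<phi> g zs \<and>
     (\<exists>U. open U \<and> zs \<in> U \<and>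
        twice_lipschitz_differentiable_on \<phi> U \<and>
        (\<forall>i. twice_lipschitz_differentiable_on (\<lambda>z. g z $ i) U))"

text \<open>Norm and distance on product types are the Euclidean ones.\<close>

definition kkt_dist :: "(real^'n \<Rightarrow> real) \<Rightarrow> (real^'n \<Rightarrow> real^'m) \<Rightarrow> real^'n \<Rightarrow> real^'n \<Rightarrow> real^'m \<Rightarrow> real" where
  "kkt_dist \<phi> g zs z lam = infdist (z, lam) (kkt_set \<phi> g zs)"

definition kkt_residual :: "(real^'n \<Rightarrow> real) \<Rightarrow> (real^'n \<Rightarrow> real^'m) \<Rightarrow> real^'n \<Rightarrow> real^'m \<Rightarrow> real" where
  "kkt_residual \<phi> g z lam =
     norm (lagr_z \<phi> g z lam, (\<chi> i. min (lam $ i) (- g z $ i)) :: real^'m)"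

definition active_est :: "(real^'n \<Rightarrow> real) \<Rightarrow> (real^'n \<Rightarrow> real^'m) \<Rightarrow> real \<Rightarrow> real^'n \<Rightarrow> real^'m \<Rightarrow> 'm set" where
  "active_est \<phi> g \<tau> z lam = {i. g z $ i \<ge> - (kkt_residual \<phi> g z lam powr \<tau>)}"

text \<open>In all definitions below, \<open>\<tau>h\<close> is the smaller exponent (\<open>0 < \<tau>h < \<tau> < 1\<close>).\<close>

definition id0_init ::
    "(real^'n \<Rightarrow> real) \<Rightarrow> (real^'n \<Rightarrow> real^'m) \<Rightarrow> real \<Rightarrow> real \<Rightarrow> real^'n \<Rightarrow> real^'m \<Rightarrow> 'm set" where
  "id0_init \<phi> g \<tau>h \<tau> z lam =
     active_est \<phi> g \<tau> z lam - {i. lam $ i \<ge> kkt_residual \<phi> g z lam powr \<tau>h}"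

definition id0_feasible ::
    "(real^'n \<Rightarrow> real) \<Rightarrow> (real^'n \<Rightarrow> real^'m) \<Rightarrow> real \<Rightarrow> real^'n \<Rightarrow> real^'m \<Rightarrow> real^'m \<Rightarrow> bool" where
  "id0_feasible \<phi> g \<tau> z lam \<mu> \<longleftrightarrow>
     (let A = active_est \<phi> g \<tau> z lam;
          \<epsilon> = kkt_residual \<phi> g z lam powr \<tau>;
          r = grad \<phi> z + (\<Sum>i\<in>A. (\<mu> $ i) *\<^sub>R grad_constr g i z)
      in (\<forall>j. - \<epsilon> \<le> r $ j \<and> r $ j \<le> \<epsilon>) \<and>
         (\<forall>i\<in>A. \<mu> $ i \<ge> 0) \<and> (\<forall>i. i \<notin> A \<longrightarrow> \<mu> $ i = 0))"

definition id0_lp_solution ::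
    "(real^'n \<Rightarrow> real) \<Rightarrow> (real^'n \<Rightarrow> real^'m) \<Rightarrow> real \<Rightarrow> real^'n \<Rightarrow> real^'m \<Rightarrow> 'm set \<Rightarrow> real^'m \<Rightarrow> bool" where
  "id0_lp_solution \<phi> g \<tau> z lam Ah \<mu> \<longleftrightarrow>
     id0_feasible \<phi> g \<tau> z lam \<mu> \<and>
     (\<forall>\<nu>. id0_feasible \<phi> g \<tau> z lam \<nu> \<longrightarrow> (\<Sum>i\<in>Ah. \<nu> $ i) \<le> (\<Sum>i\<in>Ah. \<mu> $ i))"

definition id0_large ::
    "(real^'n \<Rightarrow> real) \<Rightarrow> (real^'n \<Rightarrow> real^'m) \<Rightarrow> real \<Rightarrow> real^'n \<Rightarrow> real^'m \<Rightarrow> 'm set \<Rightarrow> real^'m \<Rightarrow> 'm set" where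
  "id0_large \<phi> g \<tau>h z lam Ah \<mu> = {i \<in> Ah. \<mu> $ i \<ge> kkt_residual \<phi> g z lam powr \<tau>h}"

text \<open>\<open>Running Ah\<close>: about to solve the linear program for the current set \<open>Ah\<close>.
  \<open>Stopped A0 Ap\<close>: finished with output \<open>A\<^sub>0 = A0\<close> and \<open>A\<^sub>+ = Ap\<close>.\<close>

datatype 'm id0_config = Running "'m set" | Stopped "'m set" "'m set"

text \<open>One pass through the loop. The step is a relation, since the linear program may have
  several solutions; it is stuck if the linear program has none.\<close>

inductive id0_step ::
    "(real^'n \<Rightarrow> real) \<Rightarrow> (real^'n \<Rightarrow> real^'m) \<Rightarrow> real \<Rightarrow> real \<Rightarrow> real^'n \<Rightarrow> real^'m \<Rightarrow>
     'm id0_config \<Rightarrow> 'm id0_config \<Rightarrow> bool"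
  for \<phi> g \<tau>h \<tau> z lam where
  stop: "id0_lp_solution \<phi> g \<tau> z lam Ah \<mu> \<Longrightarrow> id0_large \<phi> g \<tau>h z lam Ah \<mu> = {} \<Longrightarrow>
     id0_step \<phi> g \<tau>h \<tau> z lam (Running Ah) (Stopped Ah (active_est \<phi> g \<tau> z lam - Ah))"
| stop_empty: "id0_lp_solution \<phi> g \<tau> z lam Ah \<mu> \<Longrightarrow> id0_large \<phi> g \<tau>h z lam Ah \<mu> \<noteq> {} \<Longrightarrow>
     Ah - id0_large \<phi> g \<tau>h z lam Ah \<mu> = {} \<Longrightarrow>
     id0_step \<phi> g \<tau>h \<tau> z lam (Running Ah) (Stopped {} (active_est \<phi> g \<tau> z lam))"
| continue: "id0_lp_solution \<phi> g \<tau> z lam Ah \<mu> \<Longrightarrow> id0_large \<phi> g \<tau>h z lam Ah \<mu> \<noteq> {} \<Longrightarrow>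
     Ah - id0_large \<phi> g \<tau>h z lam Ah \<mu> \<noteq> {} \<Longrightarrow>
     id0_step \<phi> g \<tau>h \<tau> z lam (Running Ah) (Running (Ah - id0_large \<phi> g \<tau>h z lam Ah \<mu>))"

text \<open>Total correctness over all choices of solutions of the linear programs: no run is infinite,
  and a run that cannot be continued has stopped with the given output. As this includes runs
  that are stuck in a \<open>Running\<close> configuration, every linear program that is reached must be
  solvable.\<close>

definition id0_terminates_with ::
    "(real^'n \<Rightarrow> real) \<Rightarrow> (real^'n \<Rightarrow> real^'m) \<Rightarrow> real \<Rightarrow> real \<Rightarrow> real^'n \<Rightarrow> real^'m \<Rightarrow>
     'm set \<Rightarrow> 'm set \<Rightarrow> bool" where
  "id0_terminates_with \<phi> g \<tau>h \<tau> z lam A0 Ap \<longleftrightarrow>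
     (let step = id0_step \<phi> g \<tau>h \<tau> z lam; start = Running (id0_init \<phi> g \<tau>h \<tau> z lam) in
       (\<nexists>c :: nat \<Rightarrow> 'm id0_config. c 0 = start \<and> (\<forall>k. step (c k) (c (Suc k)))) \<and>
       (\<forall>c. step\<^sup>*\<^sup>* start c \<and> (\<nexists>c'. step c c') \<longrightarrow> c = Stopped A0 Ap))"

text \<open>At a point of \<open>S\<close> the residual, and hence both thresholds, are zero, so ID0 starts with
  the empty set and can only return \<open>A\<^sub>0 = {}\<close>. It is therefore not able to identify a
  nonempty set of weakly active indices there; off \<open>S\<close> this obstruction disappears.\<close>

lemma kkt_residual_eq_0:
  fixes g :: "real^'n \<Rightarrow> real^'m"
  assumes "(z, lam) \<in> kkt_set \<phi> g zs"
  shows "kkt_residual \<phi> g z lam = 0"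
proof -
  from assms have z: "z = zs" and L: "lagr_z \<phi> g zs lam = 0"
    and g: "\<And>i. g zs $ i \<le> 0" and l: "\<And>i. lam $ i \<ge> 0" and c: "lam \<bullet> g zs = 0"
    by (auto simp: kkt_set_def kkt_multipliers_def less_eq_vec_def)
  have "(\<Sum>i\<in>UNIV. lam $ i * (- g zs $ i)) = 0"
    using c by (simp add: inner_vec_def sum_negf)
  moreover have "\<And>i. lam $ i * (- g zs $ i) \<ge> 0"
    using g l by (simp add: mult_nonneg_nonpos)
  ultimately have "lam $ i * (- g zs $ i) = 0" for i
    using sum_nonneg_eq_0_iff[of UNIV "\<lambda>i. lam $ i * (- g zs $ i)"] by simp
  then have "min (lam $ i) (- g zs $ i) = 0" for i
    using g[of i] l[of i] by (metis min_absorb1 min_absorb2 mult_eq_0_iff neg_0_le_iff_le)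
  then have "(\<chi> i. min (lam $ i) (- g zs $ i)) = (0 :: real^'m)"
    by (simp add: vec_eq_iff)
  then show ?thesis
    by (simp add: kkt_residual_def z L norm_Pair)
qed

lemma id0_at_kkt_set:
  assumes S: "(z, lam) \<in> kkt_set \<phi> g zs"
    and T: "id0_terminates_with \<phi> g \<tau>h \<tau> z lam A0 Ap"
  shows "A0 = {}"
proof -
  have "lam $ i \<ge> 0" for i
    using S by (auto simp: kkt_set_def kkt_multipliers_def less_eq_vec_def)
  then have init: "id0_init \<phi> g \<tau>h \<tau> z lam = {}"
    by (simp add: id0_init_def kkt_residual_eq_0[OF S])
  let ?step = "id0_step \<phi> g \<tau>h \<tau> z lam"
  have fin: "c = Stopped A0 Ap" if "?step\<^sup>*\<^sup>* (Running {}) c" "\<nexists>c'. ?step c c'" for c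
    using T that by (simp add: id0_terminates_with_def Let_def init)
  then obtain c where c: "?step (Running {}) c"
    by blast
  then have c_eq: "c = Stopped {} (active_est \<phi> g \<tau> z lam)"
    by cases auto
  moreover have "\<nexists>c'. ?step c c'"
    unfolding c_eq by (auto elim: id0_step.cases)
  ultimately show ?thesis
    using fin[of c] c by auto
qed

end

theory Submission
  imports Defs
begin

text \<open>Everything rests on the error bound \<open>\<parallel>z - zs\<parallel> = O(\<eta>)\<close> near \<open>S\<close>, obtained by compactness: along
  a sequence violating it, the directions \<open>(z - zs) / \<parallel>z - zs\<parallel>\<close> accumulate at a critical direction
  on which the Hessian of the Lagrangian vanishes, against the second-order condition. As
  \<open>\<eta> = o(\<eta>\<^sup>\<tau>)\<close>, it follows that \<open>\<A>(z, \<lambda>) = \<B>\<close> and that every exact multiplier is feasible for the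
  linear program. The multiplier of a weakly active constraint vanishes throughout \<open>S\<^sub>\<lambda>\<close>, so by
  Farkas' lemma it is bounded by a constant times the violation of stationarity; in both \<open>\<lambda>\<close> and
  any feasible point of the linear program it is \<open>O(\<eta>\<^sup>\<tau>) = o(\<eta>\<^sup>\<tau>\<^sup>h)\<close>, and the index is never removed.
  If the current set still contains a strongly active index, some exact multiplier makes the
  optimal value at least a positive constant, so some entry of the solution exceeds the threshold
  and an index is removed.\<close>

section \<open>Finitely generated cones\<close>

text \<open>A finitely generated cone is closed, so a point outside it can be strictly separated
  from it. Because the cone contains 0 and all positive multiples of its generators, the separating
  functional is nonnegative on the generators and negative at \<open>v\<close>.\<close>

lemma finite_cone_farkas:
  fixes a :: "'i \<Rightarrow> 'v::euclidean_space"
  assumes "finite I" and none: "\<And>c. (\<And>i. i \<in> I \<Longrightarrow> 0 \<le> c i) \<Longrightarrow> (\<Sum>i\<in>I. c i *\<^sub>R a i) \<noteq> v"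
  obtains y where "\<And>i. i \<in> I \<Longrightarrow> 0 \<le> a i \<bullet> y" and "v \<bullet> y < 0"
proof -
  define K where "K = convex_cone hull (a ` I)"
  let ?C = "{\<Sum>i\<in>I. c i *\<^sub>R a i | c. \<forall>i\<in>I. 0 \<le> c i}"
  have "convex_cone ?C"
    unfolding convex_cone_iff
  proof (intro conjI ballI allI impI)
    show "0 \<in> ?C"
      by (rule CollectI, rule exI[of _ "\<lambda>_. 0"]) simp
    show "x + y \<in> ?C" if "x \<in> ?C" "y \<in> ?C" for x y
    proof -
      from that obtain c d where "x = (\<Sum>i\<in>I. c i *\<^sub>R a i)" "y = (\<Sum>i\<in>I. d i *\<^sub>R a i)"
        "\<forall>i\<in>I. 0 \<le> c i" "\<forall>i\<in>I. 0 \<le> d i"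
        by auto
      then show ?thesis
        by (intro CollectI exI[of _ "\<lambda>i. c i + d i"]) (simp add: scaleR_left_distrib sum.distrib)
    qed
    show "s *\<^sub>R x \<in> ?C" if "x \<in> ?C" "0 \<le> s" for x and s :: real
    proof -
      from that obtain c where "x = (\<Sum>i\<in>I. c i *\<^sub>R a i)" "\<forall>i\<in>I. 0 \<le> c i"
        by auto
      with \<open>0 \<le> s\<close> show ?thesis
        by (intro CollectI exI[of _ "\<lambda>i. s * c i"]) (simp add: scaleR_sum_right)
    qed
  qed
  moreover have "a ` I \<subseteq> ?C"
  proof
    fix x assume "x \<in> a ` I"
    then obtain j where j: "j \<in> I" "x = a j"
      by auto
    have "(\<Sum>i\<in>I. (if i = j then 1 else 0) *\<^sub>R a i) = (\<Sum>i\<in>I. if i = j then a i else 0)"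
      by (rule sum.cong) auto
    with j \<open>finite I\<close> show "x \<in> ?C"
      by (intro CollectI exI[of _ "\<lambda>i. if i = j then 1 else 0"]) (simp add: sum.delta)
  qed
  ultimately have "K \<subseteq> ?C"
    unfolding K_def by (rule hull_minimal[rotated])
  with none have "v \<notin> K"
    by fastforce
  moreover have "convex K" "closed K"
    using \<open>finite I\<close> by (auto simp: K_def convex_convex_cone_hull closed_convex_cone_hull)
  ultimately obtain y b where y: "y \<bullet> v < b" "\<And>x. x \<in> K \<Longrightarrow> y \<bullet> x > b"
    using separating_hyperplane_closed_point by metis
  have "b < 0"
    using y(2)[of 0] by (simp add: K_def convex_cone_hull_contains_0)
  have "0 \<le> a i \<bullet> y" if "i \<in> I" for i
  proof (rule ccontr)
    assume neg: "\<not> 0 \<le> a i \<bullet> y"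
    \<comment> \<open>Both \<open>b\<close> and \<open>y \<bullet> a i\<close> are negative, so this
      is a positive multiple of a generator. Its product with \<open>y\<close> is exactly
      \<open>b\<close>, against the strict separation.\<close>
    have "(b / (y \<bullet> a i)) *\<^sub>R a i \<in> K"
      unfolding K_def using that neg \<open>b < 0\<close>
      by (intro convex_cone_hull_mul hull_inc) (auto simp: inner_commute divide_nonpos_neg)
    from y(2)[OF this] neg show False
      by (simp add: inner_commute)
  qed
  with y(1) \<open>b < 0\<close> that show thesis
    by (metis inner_commute order_less_trans)
qed

text \<open>The constant comes from a dual certificate: a \<open>y\<close> with \<open>a\<^sub>i \<bullet> y > 0\<close>, \<open>a\<^sub>j \<bullet> y \<ge> 0\<close> and
  \<open>b \<bullet> y \<ge> 0\<close>, whose nonexistence would by Farkas' lemma produce a solution positive at \<open>i\<close>.\<close>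

lemma vanishing_multiplier_bound:
  fixes a :: "'i \<Rightarrow> 'v::euclidean_space"
  assumes fin: "finite B" and i: "i \<in> B"
    and sol: "\<And>j. j \<in> B \<Longrightarrow> 0 \<le> l0 j" "b + (\<Sum>j\<in>B. l0 j *\<^sub>R a j) = 0"
    and zero: "\<And>l. (\<And>j. j \<in> B \<Longrightarrow> 0 \<le> l j) \<Longrightarrow> b + (\<Sum>j\<in>B. l j *\<^sub>R a j) = 0 \<Longrightarrow> l i \<le> 0"
  obtains C where "0 \<le> C"
    and "\<And>l. (\<And>j. j \<in> B \<Longrightarrow> 0 \<le> l j) \<Longrightarrow> l i \<le> C * norm (b + (\<Sum>j\<in>B. l j *\<^sub>R a j))"
proof -
  \<comment> \<open>The option type adjoins \<open>b\<close> to the generators: index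
    \<open>None\<close> carries \<open>b\<close>, index \<open>Some j\<close> carries
    \<open>a j\<close>. The vector to be kept out of their cone is \<open>- a i\<close>.\<close>
  let ?I = "insert None (Some ` B)" and ?a = "case_option b a"
  have unit: "(\<Sum>j\<in>B. of_bool (j = i) *\<^sub>R a j) = a i"
  proof -
    have "(\<Sum>j\<in>B. of_bool (j = i) *\<^sub>R a j) = (\<Sum>j\<in>B. if j = i then a j else 0)"
      by (rule sum.cong) auto
    with fin i show ?thesis
      by simp
  qed
  have none: "(\<Sum>k\<in>?I. c k *\<^sub>R ?a k) \<noteq> - a i" if c: "\<And>k. k \<in> ?I \<Longrightarrow> 0 \<le> c k" for c
  proof
    assume eq: "(\<Sum>k\<in>?I. c k *\<^sub>R ?a k) = - a i"
    have "(\<Sum>k\<in>Some ` B. c k *\<^sub>R ?a k) = (\<Sum>j\<in>B. c (Some j) *\<^sub>R a j)"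
      by (subst sum.reindex) auto
    with eq fin have eq': "c None *\<^sub>R b + (\<Sum>j\<in>B. c (Some j) *\<^sub>R a j) + a i = 0"
      by auto
    have nn: "0 \<le> c None" "\<And>j. j \<in> B \<Longrightarrow> 0 \<le> c (Some j)"
      using c by auto
    show False
    proof (cases "c None = 0")
      \<comment> \<open>Without \<open>b\<close> the relation is homogeneous. Added to the solution
        \<open>l0\<close>, it yields a solution whose entry at \<open>i\<close> is at least
        1.\<close>
      case True
      let ?l = "\<lambda>j. l0 j + c (Some j) + of_bool (j = i)"
      have "b + (\<Sum>j\<in>B. ?l j *\<^sub>R a j) =
          (b + (\<Sum>j\<in>B. l0 j *\<^sub>R a j)) + ((\<Sum>j\<in>B. c (Some j) *\<^sub>R a j) + a i)"
        by (simp only: scaleR_left_distrib sum.distrib unit add.assoc)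
      also have "\<dots> = 0"
        using sol(2) eq' True by simp
      finally have "?l i \<le> 0"
        by (intro zero) (auto simp: sol nn)
      with sol(1)[OF i] nn(2)[OF i] show False
        by simp
    next
      \<comment> \<open>Dividing by the positive weight of \<open>b\<close> turns the relation
        itself into a solution that is positive at \<open>i\<close>.\<close>
      case False
      let ?l = "\<lambda>j. (c (Some j) + of_bool (j = i)) / c None"
      have "(\<Sum>j\<in>B. ?l j *\<^sub>R a j) = inverse (c None) *\<^sub>R ((\<Sum>j\<in>B. c (Some j) *\<^sub>R a j) + a i)"
      proof -
        have "(\<Sum>j\<in>B. ?l j *\<^sub>R a j) = (\<Sum>j\<in>B. inverse (c None) *\<^sub>R ((c (Some j) + of_bool (j = i)) *\<^sub>R a j))"
          by (rule sum.cong) (auto simp: divide_inverse mult.commute)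
        also have "\<dots> = inverse (c None) *\<^sub>R (\<Sum>j\<in>B. c (Some j) *\<^sub>R a j + of_bool (j = i) *\<^sub>R a j)"
          by (simp only: scaleR_sum_right scaleR_left_distrib)
        finally show ?thesis
          by (simp only: sum.distrib unit)
      qed
      also have "\<dots> = inverse (c None) *\<^sub>R (- (c None *\<^sub>R b))"
        using minus_unique[OF eq'[unfolded add.assoc]] by simp
      also have "\<dots> = - b"
        using False by simp
      finally have "?l i \<le> 0"
        using nn by (intro zero) auto
      moreover have "0 < ?l i"
        using nn(1) nn(2)[OF i] False by (intro divide_pos_pos) auto
      ultimately show False
        by simp
    qed
  qed
  have "finite ?I"
    using fin by simp
  then obtain y where y: "\<And>k. k \<in> ?I \<Longrightarrow> 0 \<le> ?a k \<bullet> y" "- a i \<bullet> y < 0"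
    using none by (rule finite_cone_farkas) blast+
  have yb: "0 \<le> b \<bullet> y"
    using y(1)[of None] by simp
  have yB: "0 \<le> a j \<bullet> y" if "j \<in> B" for j
    using y(1)[of "Some j"] that by simp
  have yi: "0 < a i \<bullet> y"
    using y(2) by simp
  show thesis
  proof
    show "0 \<le> norm y / (a i \<bullet> y)"
      using yi by simp
    fix l :: "'i \<Rightarrow> real" assume l: "\<And>j. j \<in> B \<Longrightarrow> 0 \<le> l j"
    let ?r = "b + (\<Sum>j\<in>B. l j *\<^sub>R a j)"
    \<comment> \<open>All terms are nonnegative, so one of them is at most the sum. Adding
      \<open>b \<bullet> y \<ge> 0\<close> gives the residual paired with \<open>y\<close>.\<close>
    have "l i * (a i \<bullet> y) \<le> (\<Sum>j\<in>B. l j * (a j \<bullet> y))"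
      by (rule member_le_sum) (use i fin l yB in auto)
    also have "\<dots> \<le> ?r \<bullet> y"
      using yb by (simp add: inner_add_left inner_sum_left)
    also have "\<dots> \<le> norm ?r * norm y"
      by (rule norm_cauchy_schwarz)
    finally show "l i \<le> norm y / (a i \<bullet> y) * norm ?r"
      using yi by (simp add: field_simps)
  qed
qed

text \<open>The quantitative form of MFCQ: pairing the combination with \<open>y\<close> gives each
  coefficient a weight of at least a fixed \<open>c > 0\<close>, so no cancellation can
  occur.\<close>

lemma pointed_cone_multiplier_bound:
  fixes a :: "'i \<Rightarrow> 'v::real_inner"
  assumes fin: "finite B" and y: "\<And>i. i \<in> B \<Longrightarrow> a i \<bullet> y < 0"
  obtains M where "0 < M"
    and "\<And>l. (\<And>i. i \<in> B \<Longrightarrow> 0 \<le> l i) \<Longrightarrow> (\<Sum>i\<in>B. l i) \<le> M * norm (\<Sum>i\<in>B. l i *\<^sub>R a i)"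
proof -
  obtain c where c: "c > 0" "\<And>i. i \<in> B \<Longrightarrow> c \<le> - (a i \<bullet> y)"
  proof (cases "B = {}")
    case True
    then show ?thesis by (intro that[of 1]) auto
  next
    case False
    show ?thesis
      by (rule that[of "Min ((\<lambda>i. - (a i \<bullet> y)) ` B)"]) (use fin False y in auto)
  qed
  show thesis
  proof
    \<comment> \<open>The summand 1 keeps the constant positive when \<open>y = 0\<close>, which is
      possible for empty \<open>B\<close>.\<close>
    show "0 < (norm y + 1) / c"
      using c(1) by (simp add: add_nonneg_pos)
    fix l :: "'i \<Rightarrow> real" assume l: "\<And>i. i \<in> B \<Longrightarrow> 0 \<le> l i"
    let ?r = "\<Sum>i\<in>B. l i *\<^sub>R a i"
    have "c * (\<Sum>i\<in>B. l i) \<le> (\<Sum>i\<in>B. l i * (- (a i \<bullet> y)))"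
      by (subst sum_distrib_left, rule sum_mono) (metis c(2) l mult.commute mult_left_mono)
    also have "\<dots> = - ?r \<bullet> y"
      by (simp add: inner_sum_left sum_negf)
    also have "\<dots> \<le> norm (- ?r) * norm y"
      by (rule norm_cauchy_schwarz)
    also have "\<dots> \<le> norm ?r * (norm y + 1)"
      by (simp add: mult_left_mono)
    finally show "(\<Sum>i\<in>B. l i) \<le> (norm y + 1) / c * norm ?r"
      using c(1) by (simp add: field_simps)
  qed
qed

section \<open>Gradients and Hessians\<close>

lemma gderiv_unique:
  fixes f :: "real^'n \<Rightarrow> real"
  assumes "GDERIV f x :> D" "GDERIV f x :> E"
  shows "D = E"
proof -
  have "(\<lambda>h. h \<bullet> D) = (\<lambda>h. h \<bullet> E)"
    using assms unfolding gderiv_def by (rule has_derivative_unique)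
  then show ?thesis
    by (metis inner_commute vector_eq_rdot)
qed

lemma grad_eqI: "GDERIV f x :> D \<Longrightarrow> grad f x = D"
  unfolding grad_def by (rule the_equality) (auto intro: gderiv_unique)

text \<open>The adjoint of the derivative, applied to 1, is the vector that represents it.
  Uniqueness identifies this vector with the definite description \<open>grad f x\<close>.\<close>

lemma gderiv_grad:
  fixes f :: "real^'n \<Rightarrow> real"
  assumes "f differentiable at x"
  shows "GDERIV f x :> grad f x"
proof -
  obtain f' where f': "(f has_derivative f') (at x)"
    using assms by (auto simp: differentiable_def)
  then interpret bounded_linear f'
    by (rule has_derivative_bounded_linear)
  have "f' h = h \<bullet> adjoint f' 1" for h
    using adjoint_works[OF linear_axioms, of h 1] by (simp add: inner_real_def)
  then have "f' = (\<lambda>h. h \<bullet> adjoint f' 1)"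
    by blast
  with f' have "GDERIV f x :> adjoint f' 1"
    unfolding gderiv_def by (rule has_derivative_eq_rhs)
  then show ?thesis
    by (simp add: grad_eqI)
qed

lemma grad_has_derivative_hess:
  assumes "grad f differentiable at x"
  shows "(grad f has_derivative (*v) (hess f x)) (at x)"
  using assms unfolding hess_def by (simp add: jacobian_works)

text \<open>Serves to compute the Hessian of the Lagrangian, whose gradient has a closed form only
  on a neighbourhood of the point.\<close>

lemma hess_eqI:
  assumes "open U" "x \<in> U" "\<And>y. y \<in> U \<Longrightarrow> grad f y = G y" "(G has_derivative G') (at x)"
  shows "hess f x *v w = G' w"
proof -
  have "(grad f has_derivative G') (at x)"
    by (rule has_derivative_transform_within_open[OF assms(4,1,2)]) (simp add: assms(3))
  moreover from this have "(grad f has_derivative (*v) (hess f x)) (at x)"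
    by (intro grad_has_derivative_hess) (auto simp: differentiable_def)
  ultimately show ?thesis
    by (metis has_derivative_unique)
qed

text \<open>The linear part contributes its operator bound, the remainder at most 1 times the
  distance. One endpoint stays fixed, as all later comparisons are with \<open>zs\<close>.\<close>

lemma has_derivative_imp_local_lipschitz:
  assumes "(f has_derivative f') (at x)"
  obtains C where "0 \<le> C" "\<forall>\<^sub>F y in nhds x. norm (f y - f x) \<le> C * norm (y - x)"
proof -
  obtain K where K: "K \<ge> 0" "\<And>h. norm (f' h) \<le> norm h * K"
    using bounded_linear.nonneg_bounded[OF has_derivative_bounded_linear[OF assms]] by blast
  obtain r where r: "r > 0" "\<And>y. norm (y - x) < r \<Longrightarrow> norm (f y - f x - f' (y - x)) \<le> 1 * norm (y - x)"
    using assms unfolding has_derivative_at_alt by (metis zero_less_one)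
  show thesis
  proof
    show "0 \<le> K + 1" using K by simp
    have "norm (f y - f x) \<le> (K + 1) * norm (y - x)" if "dist y x < r" for y
      using that r(2)[of y] K(2)[of "y - x"] norm_triangle_sub[of "f y - f x" "f' (y - x)"]
      by (simp add: distrib_right mult.commute dist_norm)
    with r(1) show "\<forall>\<^sub>F y in nhds x. norm (f y - f x) \<le> (K + 1) * norm (y - x)"
      unfolding eventually_nhds_metric by blast
  qed
qed

text \<open>Hadamard form of the derivative: the sequence of directions may vary.\<close>

lemma has_derivative_seq_quotient:
  fixes f :: "'a::real_normed_vector \<Rightarrow> 'b::real_normed_vector"
  assumes f: "(f has_derivative f') (at x)" and X: "X \<longlonglongrightarrow> x" "\<And>k. X k \<noteq> x"
    and w: "(\<lambda>k. (X k - x) /\<^sub>R norm (X k - x)) \<longlonglongrightarrow> w"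
  shows "(\<lambda>k. (f (X k) - f x) /\<^sub>R norm (X k - x)) \<longlonglongrightarrow> f' w"
proof -
  interpret bounded_linear f'
    by (rule has_derivative_bounded_linear[OF f])
  have "((\<lambda>y. (f y - f x - f' (y - x)) /\<^sub>R norm (y - x)) \<longlongrightarrow> 0) (at x)"
    using f by (simp add: has_derivative_at_within divide_inverse_commute)
  moreover have "filterlim X (at x) sequentially"
    using X by (simp add: filterlim_at)
  ultimately have "(\<lambda>k. (f (X k) - f x - f' (X k - x)) /\<^sub>R norm (X k - x)) \<longlonglongrightarrow> 0"
    by (rule filterlim_compose)
  from tendsto_add[OF this tendsto[OF w]] show ?thesis
    by (simp only: scaleR scaleR_right_distrib[symmetric] diff_add_cancel add_0_left)
qed

lemma lagr_z_eq:
  fixes g :: "real^'n \<Rightarrow> real^'m"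
  assumes "\<phi> differentiable at z" "\<And>i. (\<lambda>y. g y $ i) differentiable at z"
  shows "lagr_z \<phi> g z lam = grad \<phi> z + (\<Sum>i\<in>UNIV. lam $ i *\<^sub>R grad_constr g i z)"
  unfolding lagr_z_def
proof (rule grad_eqI)
  have "((\<lambda>y. \<phi> y + (\<Sum>i\<in>UNIV. lam $ i * g y $ i)) has_derivative
      (\<lambda>h. h \<bullet> grad \<phi> z + (\<Sum>i\<in>UNIV. lam $ i * (h \<bullet> grad_constr g i z)))) (at z)"
    using assms[THEN gderiv_grad]
    by (intro has_derivative_add has_derivative_sum has_derivative_mult_right)
      (auto simp: gderiv_def grad_constr_def)
  then show "GDERIV (\<lambda>y. lagr \<phi> g y lam) z :>
      grad \<phi> z + (\<Sum>i\<in>UNIV. lam $ i *\<^sub>R grad_constr g i z)"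
    by (simp add: gderiv_def lagr_def inner_vec_def[of lam] inner_add_right inner_sum_right)
qed

section \<open>The KKT system at the solution\<close>

locale regular_kkt_point =
  fixes \<phi> :: "real^'n \<Rightarrow> real" and g :: "real^'n \<Rightarrow> real^'m" and zs :: "real^'n"
  assumes standing: "standing_assumptions \<phi> g zs"
begin

abbreviation "\<Lambda> \<equiv> kkt_multipliers \<phi> g zs"
abbreviation "\<B> \<equiv> active g zs"
abbreviation "\<B>p \<equiv> strongly_active \<phi> g zs"
abbreviation "\<B>0 \<equiv> weakly_active \<phi> g zs"
abbreviation "\<eta> \<equiv> kkt_residual \<phi> g"
abbreviation "a \<equiv> grad_constr g"

lemma neighbourhood:
  obtains U where "open U" "zs \<in> U" "\<And>z. z \<in> U \<Longrightarrow> \<phi> differentiable at z"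
    "\<And>z i. z \<in> U \<Longrightarrow> (\<lambda>y. g y $ i) differentiable at z"
    "\<And>z lam. z \<in> U \<Longrightarrow> lagr_z \<phi> g z lam = grad \<phi> z + (\<Sum>i\<in>UNIV. lam $ i *\<^sub>R a i z)"
proof -
  obtain U where U: "open U" "zs \<in> U" "\<forall>z\<in>U. \<phi> differentiable at z"
    "\<forall>i. \<forall>z\<in>U. (\<lambda>y. g y $ i) differentiable at z"
    using standing unfolding standing_assumptions_def twice_lipschitz_differentiable_on_def by blast
  show thesis
    using U by (intro that[of U] lagr_z_eq) blast+
qed

lemma lagr_z_zs: "lagr_z \<phi> g zs lam = grad \<phi> zs + (\<Sum>i\<in>UNIV. lam $ i *\<^sub>R a i zs)"
  by (rule neighbourhood) blast

lemma constr_has_derivative: "((\<lambda>z. g z $ i) has_derivative (\<lambda>h. h \<bullet> a i zs)) (at zs)"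
proof -
  obtain U where "zs \<in> U" "\<And>z i. z \<in> U \<Longrightarrow> (\<lambda>y. g y $ i) differentiable at z"
    by (rule neighbourhood) blast
  then have "GDERIV (\<lambda>z. g z $ i) zs :> a i zs"
    unfolding grad_constr_def by (intro gderiv_grad) blast
  then show ?thesis
    by (simp add: gderiv_def)
qed

lemma grad_has_derivative:
  shows "(grad \<phi> has_derivative (*v) (hess \<phi> zs)) (at zs)"
    and "(a i has_derivative (*v) (hess (\<lambda>z. g z $ i) zs)) (at zs)"
proof -
  show "(grad \<phi> has_derivative (*v) (hess \<phi> zs)) (at zs)"
    using standing by (intro grad_has_derivative_hess)
      (auto simp: standing_assumptions_def twice_lipschitz_differentiable_on_def)
  have "a i = grad (\<lambda>z. g z $ i)"
    by (simp add: grad_constr_def fun_eq_iff)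
  then show "(a i has_derivative (*v) (hess (\<lambda>z. g z $ i) zs)) (at zs)"
    using standing
    by (auto intro!: grad_has_derivative_hess
        simp: standing_assumptions_def twice_lipschitz_differentiable_on_def)
qed

lemma lagr_zz_zs:
  "lagr_zz \<phi> g zs lam *v w =
     hess \<phi> zs *v w + (\<Sum>i\<in>UNIV. lam $ i *\<^sub>R (hess (\<lambda>z. g z $ i) zs *v w))"
proof -
  obtain U where U: "open U" "zs \<in> U"
    "\<And>z. z \<in> U \<Longrightarrow> lagr_z \<phi> g z lam = grad \<phi> z + (\<Sum>i\<in>UNIV. lam $ i *\<^sub>R a i z)"
    by (rule neighbourhood) blast
  show ?thesis
    unfolding lagr_zz_def
    by (rule hess_eqI[OF U(1,2)], fold lagr_z_def, erule U(3))
      (intro has_derivative_add has_derivative_sum has_derivative_scaleR_right grad_has_derivative)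
qed

section \<open>The polyhedron of multipliers\<close>

lemma zs_feasible: "g zs $ i \<le> 0"
  using standing by (auto simp: standing_assumptions_def kkt_multipliers_def less_eq_vec_def)

lemma multipliers_nonempty: "\<Lambda> \<noteq> {}"
  using standing by (simp add: standing_assumptions_def)

text \<open>For nonnegative \<open>lam\<close> the product \<open>lam \<bullet> g zs\<close> is a
  sum of terms of one sign, so complementarity means that \<open>lam\<close> is supported on the
  active set. The KKT system thereby becomes a linear system with sign conditions.\<close>

lemma multiplier_iff:
  "lam \<in> \<Lambda> \<longleftrightarrow> (\<forall>i. 0 \<le> lam $ i) \<and> (\<forall>i. i \<notin> \<B> \<longrightarrow> lam $ i = 0) \<and>
     grad \<phi> zs + (\<Sum>i\<in>\<B>. lam $ i *\<^sub>R a i zs) = 0"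
proof (cases "\<forall>i. 0 \<le> lam $ i")
  case True
  have "lam \<bullet> g zs = 0 \<longleftrightarrow> (\<Sum>i\<in>UNIV. - (lam $ i * g zs $ i)) = 0"
    by (simp add: inner_vec_def sum_negf)
  also have "\<dots> \<longleftrightarrow> (\<forall>i. lam $ i * g zs $ i = 0)"
    using True zs_feasible by (subst sum_nonneg_eq_0_iff) (auto simp: mult_nonneg_nonpos)
  also have "\<dots> \<longleftrightarrow> (\<forall>i. i \<notin> \<B> \<longrightarrow> lam $ i = 0)"
    by (auto simp: active_def)
  finally have compl: "lam \<bullet> g zs = 0 \<longleftrightarrow> (\<forall>i. i \<notin> \<B> \<longrightarrow> lam $ i = 0)" .
  have "(\<Sum>i\<in>UNIV. lam $ i *\<^sub>R a i zs) = (\<Sum>i\<in>\<B>. lam $ i *\<^sub>R a i zs)"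
    if "\<forall>i. i \<notin> \<B> \<longrightarrow> lam $ i = 0"
    using that by (intro sum.mono_neutral_right) auto
  with compl True zs_feasible show ?thesis
    by (auto simp: kkt_multipliers_def lagr_z_zs less_eq_vec_def)
qed (auto simp: kkt_multipliers_def less_eq_vec_def)

lemma multipliers_closed: "closed \<Lambda>"
proof -
  have "\<Lambda> = {lam. \<forall>i. 0 \<le> lam $ i} \<inter> {lam. \<forall>i. i \<notin> \<B> \<longrightarrow> lam $ i = 0} \<inter>
      {lam. grad \<phi> zs + (\<Sum>i\<in>\<B>. lam $ i *\<^sub>R a i zs) = 0}"
    using multiplier_iff by blast
  moreover have "closed {lam::real^'m. \<forall>i. 0 \<le> lam $ i}"
    "closed {lam::real^'m. \<forall>i. i \<notin> \<B> \<longrightarrow> lam $ i = 0}"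
    "closed {lam. grad \<phi> zs + (\<Sum>i\<in>\<B>. lam $ i *\<^sub>R a i zs) = 0}"
    by (intro closed_Collect_all closed_Collect_le closed_Collect_imp closed_Collect_eq
        open_Collect_const continuous_intros)+
  ultimately show ?thesis
    by (simp only: closed_Int)
qed

lemma active_multiplier_bound:
  obtains M where "0 < M"
    "\<And>l. (\<And>i. i \<in> \<B> \<Longrightarrow> 0 \<le> l i) \<Longrightarrow> (\<Sum>i\<in>\<B>. l i) \<le> M * norm (\<Sum>i\<in>\<B>. l i *\<^sub>R a i zs)"
proof -
  obtain y where "\<And>i. i \<in> \<B> \<Longrightarrow> a i zs \<bullet> y < 0"
    using standing by (auto simp: standing_assumptions_def mfcq_def)
  then show thesis
    using that by (rule pointed_cone_multiplier_bound[rotated]) auto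
qed

text \<open>Stationarity fixes the combination of active gradients to be
  \<open>- grad \<phi> zs\<close>, so the MFCQ bound is uniform over all multipliers.\<close>

lemma multipliers_bounded:
  obtains M where "0 < M" "\<And>lam. lam \<in> \<Lambda> \<Longrightarrow> norm lam \<le> M" "\<And>lam i. lam \<in> \<Lambda> \<Longrightarrow> \<bar>lam $ i\<bar> \<le> M"
proof -
  obtain M where M: "0 < M"
    "\<And>l. (\<And>i. i \<in> \<B> \<Longrightarrow> 0 \<le> l i) \<Longrightarrow> (\<Sum>i\<in>\<B>. l i) \<le> M * norm (\<Sum>i\<in>\<B>. l i *\<^sub>R a i zs)"
    using active_multiplier_bound by blast
  have "norm lam \<le> M * norm (grad \<phi> zs)" if "lam \<in> \<Lambda>" for lam
  proof -
    have lam: "\<And>i. 0 \<le> lam $ i" "\<And>i. i \<notin> \<B> \<Longrightarrow> lam $ i = 0"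
      "grad \<phi> zs + (\<Sum>i\<in>\<B>. lam $ i *\<^sub>R a i zs) = 0"
      using that multiplier_iff by auto
    have "norm lam \<le> (\<Sum>i\<in>UNIV. \<bar>lam $ i\<bar>)"
      by (rule norm_le_l1_cart)
    also have "\<dots> = (\<Sum>i\<in>\<B>. lam $ i)"
      using lam by (intro sum.mono_neutral_cong_right) auto
    also have "\<dots> \<le> M * norm (\<Sum>i\<in>\<B>. lam $ i *\<^sub>R a i zs)"
      using lam by (intro M(2)) auto
    also have "norm (\<Sum>i\<in>\<B>. lam $ i *\<^sub>R a i zs) = norm (grad \<phi> zs)"
      using minus_unique[OF lam(3)] norm_minus_cancel[of "grad \<phi> zs"] by simp
    finally show ?thesis .
  qed
  then have bound: "norm lam \<le> M * norm (grad \<phi> zs) + 1" if "lam \<in> \<Lambda>" for lam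
    using that by fastforce
  show thesis
  proof
    show "0 < M * norm (grad \<phi> zs) + 1"
      using M(1) by (simp add: add_nonneg_pos)
    show "norm lam \<le> M * norm (grad \<phi> zs) + 1" if "lam \<in> \<Lambda>" for lam
      using that by (rule bound)
    show "\<bar>lam $ i\<bar> \<le> M * norm (grad \<phi> zs) + 1" if "lam \<in> \<Lambda>" for lam i
      using component_le_norm_cart bound[OF that] by (rule order_trans)
  qed
qed

text \<open>The solution set is closed and nonempty, so a nearest point exists. Its first component
  can only be \<open>zs\<close>, and each component of the difference is dominated by the product
  norm.\<close>

lemma kkt_dist_attained:
  obtains ls where "ls \<in> \<Lambda>" "norm (z - zs) \<le> kkt_dist \<phi> g zs z lam" "norm (lam - ls) \<le> kkt_dist \<phi> g zs z lam"
proof -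
  have "closed (kkt_set \<phi> g zs)" "kkt_set \<phi> g zs \<noteq> {}"
    using multipliers_closed multipliers_nonempty by (auto simp: kkt_set_def intro: closed_Times)
  then obtain p where "p \<in> kkt_set \<phi> g zs" "kkt_dist \<phi> g zs z lam = dist (z, lam) p"
    unfolding kkt_dist_def by (rule infdist_attains_inf)
  then obtain ls where "ls \<in> \<Lambda>" "kkt_dist \<phi> g zs z lam = dist (z, lam) (zs, ls)"
    by (auto simp: kkt_set_def)
  then show thesis
    using that dist_fst_le[of "(z, lam)" "(zs, ls)"] dist_snd_le[of "(z, lam)" "(zs, ls)"]
    by (simp add: dist_norm)
qed

section \<open>Elementary estimates of the residual\<close>

lemma residual_nonneg: "0 \<le> \<eta> z lam"
  by (simp add: kkt_residual_def)

lemma lagr_z_le_residual: "norm (lagr_z \<phi> g z lam) \<le> \<eta> z lam"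
  unfolding kkt_residual_def by (rule norm_fst_le)

lemma compl_le_residual: "\<bar>min (lam $ i) (- g z $ i)\<bar> \<le> \<eta> z lam"
proof -
  have "\<bar>min (lam $ i) (- g z $ i)\<bar> \<le> norm (\<chi> i. min (lam $ i) (- g z $ i))"
    using component_le_norm_cart[of "\<chi> i. min (lam $ i) (- g z $ i)" i] by simp
  also have "\<dots> \<le> \<eta> z lam"
    unfolding kkt_residual_def by (rule norm_snd_le)
  finally show ?thesis .
qed

lemma residual_le_sum:
  "\<eta> z lam \<le> norm (lagr_z \<phi> g z lam) + (\<Sum>i\<in>UNIV. \<bar>min (lam $ i) (- g z $ i)\<bar>)"
proof -
  have "\<eta> z lam \<le> norm (lagr_z \<phi> g z lam) + norm (\<chi> i. min (lam $ i) (- g z $ i))"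
    unfolding kkt_residual_def by (rule norm_Pair_le)
  also have "norm (\<chi> i. min (lam $ i) (- g z $ i)) \<le> (\<Sum>i\<in>UNIV. \<bar>min (lam $ i) (- g z $ i)\<bar>)"
    using norm_le_l1_cart[of "\<chi> i. min (lam $ i) (- g z $ i)"] by simp
  finally show ?thesis by simp
qed

section \<open>The error bound\<close>

text \<open>The limit direction \<open>w\<close> of a sequence along which the residual is \<open>o(\<parallel>z - zs\<parallel>)\<close> is a
  critical direction, and pairing the Lagrangian gradient with \<open>w\<close> shows that the Hessian of the
  Lagrangian at the limit multiplier vanishes on it.\<close>

lemma no_superlinear_residual:
  assumes X: "X \<longlonglongrightarrow> zs" "\<And>k. X k \<noteq> zs" and L: "L \<longlonglongrightarrow> l" "l \<in> \<Lambda>"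
    and w: "(\<lambda>k. (X k - zs) /\<^sub>R norm (X k - zs)) \<longlonglongrightarrow> w"
    and small: "(\<lambda>k. \<eta> (X k) (L k) / norm (X k - zs)) \<longlonglongrightarrow> 0"
  shows False
proof -
  define t where "t k = norm (X k - zs)" for k
  have t: "t k > 0" for k
    using X(2) by (simp add: t_def)
  have t0: "t \<longlonglongrightarrow> 0"
    unfolding t_def using tendsto_norm_zero[OF LIM_zero[OF X(1)]] by simp
  \<comment> \<open>Every quantity dominated by the residual is \<open>o(t)\<close>. This is applied
    to the complementarity terms and to the Lagrangian gradient paired with
    \<open>w\<close>.\<close>
  have quot_zero: "(\<lambda>k. x k / t k) \<longlonglongrightarrow> 0" if "\<And>k. \<bar>x k\<bar> \<le> \<eta> (X k) (L k)" for x :: "nat \<Rightarrow> real"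
  proof (rule Lim_null_comparison)
    show "(\<lambda>k. \<eta> (X k) (L k) / t k) \<longlonglongrightarrow> 0"
      using small by (simp add: t_def)
    show "\<forall>\<^sub>F k in sequentially. norm (x k / t k) \<le> \<eta> (X k) (L k) / t k"
      using that t by (simp add: abs_divide divide_right_mono less_imp_le)
  qed
  have minq: "(\<lambda>k. min (L k $ i) (- g (X k) $ i) / t k) \<longlonglongrightarrow> 0" for i
    by (rule quot_zero) (rule compl_le_residual)
  have gq: "(\<lambda>k. (g (X k) $ i - g zs $ i) / t k) \<longlonglongrightarrow> w \<bullet> a i zs" for i
    using has_derivative_seq_quotient[OF constr_has_derivative X w]
    by (simp add: t_def divide_inverse_commute)
  have Li: "(\<lambda>k. L k $ i) \<longlonglongrightarrow> l $ i" for i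
    using L(1) by (rule tendsto_vec_nth)
  have mult: "\<And>i. 0 \<le> l $ i" "\<And>i. i \<notin> \<B> \<Longrightarrow> l $ i = 0"
    using L(2) multiplier_iff by auto

  \<comment> \<open>The minimum is at most \<open>- g (X k) $ i\<close>; dividing by
    \<open>t\<close> and passing to the limit gives the sign.\<close>
  have le: "w \<bullet> a i zs \<le> 0" if "i \<in> \<B>" for i
  proof -
    have "0 \<le> - (w \<bullet> a i zs)"
    proof (rule tendsto_le[OF _ tendsto_minus[OF gq] minq])
      show "\<forall>\<^sub>F k in sequentially. min (L k $ i) (- g (X k) $ i) / t k \<le> - ((g (X k) $ i - g zs $ i) / t k)"
      proof (intro always_eventually allI)
        fix k
        have "min (L k $ i) (- g (X k) $ i) / t k \<le> - g (X k) $ i / t k"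
          using t[of k] by (intro divide_right_mono) auto
        then show "min (L k $ i) (- g (X k) $ i) / t k \<le> - ((g (X k) $ i - g zs $ i) / t k)"
          using that by (simp add: active_def)
      qed
    qed simp
    then show ?thesis by simp
  qed

  text \<open>A constraint that is not active to first order forces its multiplier to be \<open>o(t)\<close>.\<close>

  have Lq: "(\<lambda>k. L k $ i / t k) \<longlonglongrightarrow> 0" if ev: "\<forall>\<^sub>F k in sequentially. min (L k $ i) (- g (X k) $ i) \<noteq> - g (X k) $ i" for i
    by (rule Lim_transform_eventually[OF minq[of i]])
      (use ev in eventually_elim, auto simp: min_def split: if_splits)
  \<comment> \<open>The minimum tends to 0 while \<open>- g\<close> stays away from 0, so eventually
    the minimum is the multiplier.\<close>
  have Lq_inactive: "(\<lambda>k. L k $ i / t k) \<longlonglongrightarrow> 0" if "i \<notin> \<B>" for i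
  proof (rule Lq)
    have neg: "g zs $ i < 0"
      using that zs_feasible[of i] by (simp add: active_def)
    have "(\<lambda>k. min (L k $ i) (- g (X k) $ i) / t k * t k) \<longlonglongrightarrow> 0 * 0"
      by (intro tendsto_mult minq t0)
    then have "(\<lambda>k. min (L k $ i) (- g (X k) $ i)) \<longlonglongrightarrow> 0"
      using t by (simp add: less_imp_neq[symmetric])
    moreover have "(\<lambda>k. (g (X k) $ i - g zs $ i) / t k * t k + g zs $ i) \<longlonglongrightarrow> (w \<bullet> a i zs) * 0 + g zs $ i"
      by (intro tendsto_intros gq t0)
    then have "(\<lambda>k. g (X k) $ i) \<longlonglongrightarrow> g zs $ i"
      using t by (simp add: less_imp_neq[symmetric])
    ultimately have "(\<lambda>k. min (L k $ i) (- g (X k) $ i) + g (X k) $ i) \<longlonglongrightarrow> 0 + g zs $ i"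
      by (rule tendsto_add)
    then have "\<forall>\<^sub>F k in sequentially. min (L k $ i) (- g (X k) $ i) + g (X k) $ i < 0"
      using neg by (intro order_tendstoD(2)) auto
    then show "\<forall>\<^sub>F k in sequentially. min (L k $ i) (- g (X k) $ i) \<noteq> - g (X k) $ i"
      by eventually_elim auto
  qed
  \<comment> \<open>The same argument at first order: the minimum plus \<open>g\<close>, divided by
    \<open>t\<close>, tends to \<open>w \<bullet> a i zs < 0\<close>.\<close>
  have Lq_neg: "(\<lambda>k. L k $ i / t k) \<longlonglongrightarrow> 0" if "i \<in> \<B>" "w \<bullet> a i zs < 0" for i
  proof (rule Lq)
    have "(\<lambda>k. min (L k $ i) (- g (X k) $ i) / t k + (g (X k) $ i - g zs $ i) / t k) \<longlonglongrightarrow> 0 + w \<bullet> a i zs"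
      by (intro tendsto_add minq gq)
    then have "\<forall>\<^sub>F k in sequentially. min (L k $ i) (- g (X k) $ i) / t k + (g (X k) $ i - g zs $ i) / t k < 0"
      using that by (intro order_tendstoD(2)) auto
    then show "\<forall>\<^sub>F k in sequentially. min (L k $ i) (- g (X k) $ i) \<noteq> - g (X k) $ i"
      by eventually_elim (use that in \<open>auto simp: active_def\<close>)
  qed
  have dichotomy: "w \<bullet> a i zs = 0 \<or> (\<lambda>k. L k $ i / t k) \<longlonglongrightarrow> 0" for i
    using Lq_inactive Lq_neg le[of i] by (metis order_le_less)
  have l_compl: "l $ i * (w \<bullet> a i zs) = 0" for i
  proof (cases "w \<bullet> a i zs = 0")
    case False
    then have "(\<lambda>k. L k $ i / t k * t k) \<longlonglongrightarrow> 0 * 0"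
      using dichotomy by (intro tendsto_mult t0) blast
    then have "(\<lambda>k. L k $ i) \<longlonglongrightarrow> 0"
      using t by (simp add: less_imp_neq[symmetric])
    then show ?thesis
      using LIMSEQ_unique[OF Li] by simp
  qed simp

  have pair: "w \<bullet> grad \<phi> zs + (\<Sum>i\<in>\<B>. lam $ i * (w \<bullet> a i zs)) = 0" if "lam \<in> \<Lambda>" for lam
  proof -
    have "w \<bullet> (grad \<phi> zs + (\<Sum>i\<in>\<B>. lam $ i *\<^sub>R a i zs)) = 0"
      using that multiplier_iff by simp
    then show ?thesis
      by (simp add: inner_add_right inner_sum_right)
  qed
  have grad0: "w \<bullet> grad \<phi> zs = 0"
    using pair[OF L(2)] l_compl by simp
  \<comment> \<open>Since \<open>w\<close> annihilates \<open>grad \<phi> zs\<close>, pairing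
    stationarity for any multiplier with \<open>w\<close> leaves a sum of terms of one sign that
    equals 0. A multiplier positive at \<open>i\<close> then forces the claim.\<close>
  have strong: "w \<bullet> a i zs = 0" if strong_i: "i \<in> \<B>p" for i
  proof -
    obtain lam where lam: "lam \<in> \<Lambda>" "lam $ i > 0" and i: "i \<in> \<B>"
      using strong_i by (auto simp: strongly_active_def)
    have "(\<Sum>i\<in>\<B>. - (lam $ i * (w \<bullet> a i zs))) = 0"
      using pair[OF lam(1)] grad0 by (simp add: sum_negf)
    moreover have "0 \<le> - (lam $ i * (w \<bullet> a i zs))" if "i \<in> \<B>" for i
      using le[OF that] lam(1) multiplier_iff by (simp add: mult_nonneg_nonpos)
    ultimately have "\<forall>i\<in>\<B>. - (lam $ i * (w \<bullet> a i zs)) = 0"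
      by (subst (asm) sum_nonneg_eq_0_iff) auto
    with i lam(2) show ?thesis by auto
  qed
  obtain \<alpha> where \<alpha>: "\<alpha> > 0" "\<And>lam w. lam \<in> \<Lambda> \<Longrightarrow> (\<And>i. i \<in> \<B>p \<Longrightarrow> a i zs \<bullet> w = 0) \<Longrightarrow>
      (\<And>i. i \<in> \<B>0 \<Longrightarrow> a i zs \<bullet> w \<le> 0) \<Longrightarrow> w \<bullet> (lagr_zz \<phi> g zs lam *v w) \<ge> \<alpha> * (norm w)\<^sup>2"
    using standing unfolding standing_assumptions_def second_order_sufficient_def by blast
  have "\<alpha> * (norm w)\<^sup>2 \<le> w \<bullet> (lagr_zz \<phi> g zs l *v w)"
    using L(2) strong le by (intro \<alpha>(2)) (auto simp: inner_commute weakly_active_def)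
  moreover have "norm w = 1"
  proof -
    have "(\<lambda>k. norm ((X k - zs) /\<^sub>R norm (X k - zs))) = (\<lambda>k. 1)"
      using X(2) by (simp add: fun_eq_iff)
    with tendsto_norm[OF w] show ?thesis
      by (simp add: LIMSEQ_const_iff)
  qed
  \<comment> \<open>\<open>?q\<close> is the Lagrangian gradient paired with \<open>w\<close>,
    divided by \<open>t\<close> and expanded at \<open>zs\<close>. The difference quotients produce
    the Hessian term. The last sum vanishes in the limit by \<open>dichotomy\<close>, and
    \<open>grad0\<close> removes the constant term.\<close>
  moreover have "w \<bullet> (lagr_zz \<phi> g zs l *v w) = 0"
  proof (rule LIMSEQ_unique)
    let ?q = "\<lambda>k. w \<bullet> ((grad \<phi> (X k) - grad \<phi> zs) /\<^sub>R t k) +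
      (\<Sum>i\<in>UNIV. L k $ i * (w \<bullet> ((a i (X k) - a i zs) /\<^sub>R t k))) +
      (\<Sum>i\<in>UNIV. L k $ i / t k * (w \<bullet> a i zs))"
    have "(\<lambda>k. L k $ i / t k * (w \<bullet> a i zs)) \<longlonglongrightarrow> 0" for i
      using dichotomy[of i]
    proof
      assume "(\<lambda>k. L k $ i / t k) \<longlonglongrightarrow> 0"
      then show ?thesis
        by (rule tendsto_mult_left_zero)
    qed simp
    then have "?q \<longlonglongrightarrow> w \<bullet> (hess \<phi> zs *v w) +
      (\<Sum>i\<in>UNIV. l $ i * (w \<bullet> (hess (\<lambda>z. g z $ i) zs *v w))) + (\<Sum>i\<in>(UNIV::'m set). 0)"
      unfolding t_def
      by (intro tendsto_add tendsto_sum tendsto_mult Li tendsto_inner tendsto_const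
          has_derivative_seq_quotient[OF _ X w] grad_has_derivative)
    then show "?q \<longlonglongrightarrow> w \<bullet> (lagr_zz \<phi> g zs l *v w)"
      by (simp add: lagr_zz_zs inner_add_right inner_sum_right)
    obtain U where U: "open U" "zs \<in> U"
      "\<And>z lam. z \<in> U \<Longrightarrow> lagr_z \<phi> g z lam = grad \<phi> z + (\<Sum>i\<in>UNIV. lam $ i *\<^sub>R a i z)"
      by (rule neighbourhood) blast
    have lag0: "(\<lambda>k. w \<bullet> lagr_z \<phi> g (X k) (L k) / t k) \<longlonglongrightarrow> 0"
    proof (rule quot_zero)
      show "\<bar>w \<bullet> lagr_z \<phi> g (X k) (L k)\<bar> \<le> \<eta> (X k) (L k)" for k
        using Cauchy_Schwarz_ineq2[of w "lagr_z \<phi> g (X k) (L k)"] lagr_z_le_residual[of "X k" "L k"]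
          \<open>norm w = 1\<close> by simp
    qed
    have "\<forall>\<^sub>F k in sequentially. X k \<in> U"
      using X(1) U(1,2) by (simp add: tendsto_def)
    then have "\<forall>\<^sub>F k in sequentially. w \<bullet> lagr_z \<phi> g (X k) (L k) / t k = ?q k"
    proof eventually_elim
      case (elim k)
      have "lagr_z \<phi> g (X k) (L k) = grad \<phi> zs + (grad \<phi> (X k) - grad \<phi> zs) +
        (\<Sum>i\<in>UNIV. L k $ i *\<^sub>R (a i (X k) - a i zs)) + (\<Sum>i\<in>UNIV. L k $ i *\<^sub>R a i zs)"
        by (simp add: U(3)[OF elim] scaleR_diff_right sum_subtractf)
      then have "w \<bullet> lagr_z \<phi> g (X k) (L k) = w \<bullet> (grad \<phi> (X k) - grad \<phi> zs) +
        (\<Sum>i\<in>UNIV. L k $ i * (w \<bullet> (a i (X k) - a i zs))) + (\<Sum>i\<in>UNIV. L k $ i * (w \<bullet> a i zs))"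
        by (simp only: inner_add_right inner_sum_right inner_scaleR_right grad0 add_0_left)
      then show ?case
        by (simp only: distrib_left sum_distrib_left inner_scaleR_right divide_inverse
            mult.assoc mult.left_commute mult.commute)
    qed
    then show "?q \<longlonglongrightarrow> 0"
      by (rule Lim_transform_eventually[OF lag0])
  qed
  ultimately show False
    using \<alpha>(1) by simp
qed

text \<open>If every constant \<open>k + 1\<close> fails within radius \<open>1 / (k + 1)\<close>,
  the counterexamples approach the solution set with residual \<open>o(norm (z - zs))\<close>, which
  the preceding lemma excludes.\<close>

lemma error_bound:
  obtains C \<delta> where "0 < C" "0 < \<delta>"
    "\<And>z lam. kkt_dist \<phi> g zs z lam \<le> \<delta> \<Longrightarrow> norm (z - zs) \<le> C * \<eta> z lam"
proof (rule ccontr)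
  assume no: "\<not> thesis"
  have "\<exists>z lam. kkt_dist \<phi> g zs z lam \<le> inverse (Suc k) \<and> real (Suc k) * \<eta> z lam < norm (z - zs)" for k
  proof (rule ccontr)
    assume "\<not> ?thesis"
    then have "thesis"
      by (intro that[of "real (Suc k)" "inverse (Suc k)"]) (auto simp: not_less)
    with no show False ..
  qed
  then obtain X0 L0 where XL: "\<And>k. kkt_dist \<phi> g zs (X0 k) (L0 k) \<le> inverse (Suc k)"
    "\<And>k. real (Suc k) * \<eta> (X0 k) (L0 k) < norm (X0 k - zs)"
    by metis
  have "\<exists>P. P \<in> \<Lambda> \<and> norm (X0 k - zs) \<le> inverse (Suc k) \<and> norm (L0 k - P) \<le> inverse (Suc k)" for k
    using kkt_dist_attained[of "X0 k" "L0 k"] XL(1)[of k] by (metis order_trans)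
  then obtain P where P: "\<And>k. P k \<in> \<Lambda>" "\<And>k. norm (X0 k - zs) \<le> inverse (Suc k)"
    "\<And>k. norm (L0 k - P k) \<le> inverse (Suc k)"
    by metis
  have X0: "X0 \<longlonglongrightarrow> zs"
    by (rule LIM_zero_cancel, rule Lim_null_comparison[OF always_eventually LIMSEQ_inverse_real_of_nat])
      (use P(2) in blast)
  have LP: "(\<lambda>k. L0 k - P k) \<longlonglongrightarrow> 0"
    by (rule Lim_null_comparison[OF always_eventually LIMSEQ_inverse_real_of_nat])
      (use P(3) in blast)
  have ne: "X0 k \<noteq> zs" for k
  proof
    assume "X0 k = zs"
    with XL(2)[of k] have "real (Suc k) * \<eta> (X0 k) (L0 k) < 0" by simp
    with residual_nonneg[of "X0 k" "L0 k"] show False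
      by (simp add: mult_less_0_iff)
  qed
  have "compact \<Lambda>"
    using multipliers_closed multipliers_bounded
    by (metis bounded_iff compact_eq_bounded_closed)
  \<comment> \<open>Compactness of the product yields one subsequence along which the directions and
    the nearest multipliers converge together.\<close>
  then have "seq_compact (sphere (0::real^'n) 1 \<times> \<Lambda>)"
    by (intro compact_imp_seq_compact compact_Times) auto
  moreover have "\<forall>k. ((X0 k - zs) /\<^sub>R norm (X0 k - zs), P k) \<in> sphere 0 1 \<times> \<Lambda>"
    using P(1) ne by simp
  ultimately obtain p r where p: "p \<in> sphere (0::real^'n) 1 \<times> \<Lambda>" and r: "strict_mono r"
    and lim: "((\<lambda>k. ((X0 k - zs) /\<^sub>R norm (X0 k - zs), P k)) \<circ> r) \<longlonglongrightarrow> p"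
    by (rule seq_compactE)
  show False
  proof (rule no_superlinear_residual)
    show "(X0 \<circ> r) \<longlonglongrightarrow> zs"
      using X0 r by (rule LIMSEQ_subseq_LIMSEQ)
    show "(X0 \<circ> r) k \<noteq> zs" for k
      using ne by simp
    show "(\<lambda>k. ((X0 \<circ> r) k - zs) /\<^sub>R norm ((X0 \<circ> r) k - zs)) \<longlonglongrightarrow> fst p"
      using tendsto_fst[OF lim] by (simp add: o_def)
    have "(\<lambda>k. P (r k)) \<longlonglongrightarrow> snd p"
      using tendsto_snd[OF lim] by (simp add: o_def)
    from tendsto_add[OF LIMSEQ_subseq_LIMSEQ[OF LP r] this] show "(L0 \<circ> r) \<longlonglongrightarrow> snd p"
      by (simp add: o_def)
    show "snd p \<in> \<Lambda>"
      using p by auto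
    have "(\<lambda>k. \<eta> (X0 k) (L0 k) / norm (X0 k - zs)) \<longlonglongrightarrow> 0"
    proof (rule Lim_null_comparison[OF always_eventually LIMSEQ_inverse_real_of_nat], rule allI)
      fix k
      have "\<eta> (X0 k) (L0 k) / norm (X0 k - zs) \<le> inverse (real (Suc k))"
        using XL(2)[of k] ne[of k] by (simp add: field_simps)
      then show "norm (\<eta> (X0 k) (L0 k) / norm (X0 k - zs)) \<le> inverse (real (Suc k))"
        by (simp add: residual_nonneg)
    qed
    from LIMSEQ_subseq_LIMSEQ[OF this r]
    show "(\<lambda>k. \<eta> ((X0 \<circ> r) k) ((L0 \<circ> r) k) / norm ((X0 \<circ> r) k - zs)) \<longlonglongrightarrow> 0"
      by (simp add: o_def)
  qed
qed

end

section \<open>Runs of Procedure ID0\<close>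

text \<open>The quotient of the two powers is a positive power, which tends to 0 from the right. The
  strict inequality needs \<open>0 < x\<close>, since at \<open>x = 0\<close> both powers are
  0.\<close>

lemma powr_eventually_dominated:
  fixes p q Q :: real
  assumes "p < q"
  shows "\<forall>\<^sub>F x in nhds 0. 0 < x \<longrightarrow> Q * x powr q < x powr p"
proof -
  have pos: "\<forall>\<^sub>F x::real in at_right 0. 0 < x"
    by (auto simp: eventually_at_filter)
  have "((\<lambda>x. Q * x powr (q - p)) \<longlongrightarrow> Q * 0) (at_right 0)"
    using assms pos
    by (intro tendsto_mult tendsto_const tendsto_zero_powrI[where b = "q - p"])
      (auto elim: eventually_mono simp: tendsto_ident_at)
  then have "\<forall>\<^sub>F x in at_right 0. Q * x powr (q - p) < 1"
    by (rule order_tendstoD(2)) simp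
  with pos have "\<forall>\<^sub>F x in at_right 0. Q * x powr q < x powr p"
  proof eventually_elim
    case (elim x)
    then have "Q * x powr (q - p) * x powr p < 1 * x powr p"
      by (intro mult_strict_right_mono) auto
    then show ?case
      by (simp add: mult.assoc flip: powr_add)
  qed
  then show ?thesis
    by (auto simp: eventually_at_filter elim: eventually_mono)
qed

lemma id0_lp_solution_exists:
  fixes g :: "real^'n \<Rightarrow> real^'m"
  assumes "id0_feasible \<phi> g \<tau> z lam \<mu>0" and "bounded {\<mu>. id0_feasible \<phi> g \<tau> z lam \<mu>}"
  obtains \<mu> where "id0_lp_solution \<phi> g \<tau> z lam Ah \<mu>"
proof -
  let ?F = "{\<mu>. id0_feasible \<phi> g \<tau> z lam \<mu>}"
  have "closed ?F"
    unfolding id0_feasible_def Let_def Ball_def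
    by (intro closed_Collect_conj closed_Collect_all closed_Collect_le closed_Collect_imp
        closed_Collect_eq open_Collect_const continuous_intros)
  with assms(2) have "compact ?F"
    by (simp add: compact_eq_bounded_closed)
  moreover have "?F \<noteq> {}"
    using assms(1) by auto
  moreover have "continuous_on ?F (\<lambda>\<mu>. \<Sum>i\<in>Ah. \<mu> $ i)"
    by (intro continuous_intros)
  ultimately have "\<exists>\<mu>\<in>?F. \<forall>\<nu>\<in>?F. (\<Sum>i\<in>Ah. \<nu> $ i) \<le> (\<Sum>i\<in>Ah. \<mu> $ i)"
    by (rule continuous_attains_sup)
  then show thesis
    using that unfolding id0_lp_solution_def by blast
qed

text \<open>The combinatorial part of the argument. The current set always contains \<open>W\<close>
  and can only lose members of \<open>S\<close>; while it meets \<open>S\<close> the loop cannot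
  stop with it, so it shrinks to exactly \<open>W\<close>.\<close>

lemma id0_terminates_withI:
  fixes g :: "real^'n \<Rightarrow> real^'m"
  assumes A: "active_est \<phi> g \<tau> z lam = S \<union> W" and disj: "S \<inter> W = {}"
    and init: "W \<subseteq> id0_init \<phi> g \<tau>h \<tau> z lam"
    and solvable: "\<And>Ah. \<exists>\<mu>. id0_lp_solution \<phi> g \<tau> z lam Ah \<mu>"
    and weak: "\<And>Ah \<mu>. id0_lp_solution \<phi> g \<tau> z lam Ah \<mu> \<Longrightarrow> id0_large \<phi> g \<tau>h z lam Ah \<mu> \<inter> W = {}"
    and strong: "\<And>Ah \<mu>. id0_lp_solution \<phi> g \<tau> z lam Ah \<mu> \<Longrightarrow> Ah \<inter> S \<noteq> {} \<Longrightarrow>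
      id0_large \<phi> g \<tau>h z lam Ah \<mu> \<noteq> {}"
  shows "id0_terminates_with \<phi> g \<tau>h \<tau> z lam W S"
proof -
  let ?step = "id0_step \<phi> g \<tau>h \<tau> z lam" and ?start = "Running (id0_init \<phi> g \<tau>h \<tau> z lam)"
  define inv where "inv c = (case c of Running Ah \<Rightarrow> W \<subseteq> Ah \<and> Ah \<subseteq> S \<union> W | Stopped A0 Ap \<Rightarrow> A0 = W \<and> Ap = S)" for c
  \<comment> \<open>\<open>Suc\<close> places a stopped configuration strictly below a running one
    even if the current set is empty.\<close>
  define rank where "rank c = (case c of Running Ah \<Rightarrow> Suc (card Ah) | Stopped A0 Ap \<Rightarrow> 0)" for c :: "'m id0_config"
  have start: "inv ?start"
    using init A by (auto simp: inv_def id0_init_def)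
  have step_inv: "inv c'" if "?step c c'" "inv c" for c c'
    using that
  proof cases
    case (stop Ah \<mu>)
    then have "Ah \<inter> S = {}"
      using strong by blast
    with stop \<open>inv c\<close> A disj show ?thesis
      by (auto simp: inv_def)
  next
    \<comment> \<open>No member of \<open>W\<close> is removed, so an emptied current set forces
      \<open>W = {}\<close>, in agreement with the output.\<close>
    case (stop_empty Ah \<mu>)
    with \<open>inv c\<close> weak[OF stop_empty(3)] A show ?thesis
      by (auto simp: inv_def)
  next
    case (continue Ah \<mu>)
    with \<open>inv c\<close> weak[OF continue(3)] show ?thesis
      by (auto simp: inv_def)
  qed
  have step_rank: "rank c' < rank c" if "?step c c'" for c c'
    using that
  proof cases
    case (continue Ah \<mu>)
    have "card (Ah - id0_large \<phi> g \<tau>h z lam Ah \<mu>) < card Ah"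
      using continue(4) by (intro psubset_card_mono) (auto simp: id0_large_def)
    with continue show ?thesis
      by (simp add: rank_def)
  qed (auto simp: rank_def)
  have "\<not> (\<exists>c. c 0 = ?start \<and> (\<forall>k. ?step (c k) (c (Suc k))))"
  proof
    assume "\<exists>c. c 0 = ?start \<and> (\<forall>k. ?step (c k) (c (Suc k)))"
    then obtain c where "\<forall>k. (c (Suc k), c k) \<in> Wellfounded.measure rank"
      using step_rank by auto
    with wf_measure[of rank] show False
      unfolding wf_iff_no_infinite_down_chain by blast
  qed
  moreover have "c = Stopped W S" if "?step\<^sup>*\<^sup>* ?start c" and stuck: "\<nexists>c'. ?step c c'" for c
  proof (cases c)
    case (Running Ah)
    obtain \<mu> where "id0_lp_solution \<phi> g \<tau> z lam Ah \<mu>"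
      using solvable by blast
    then have "\<exists>c'. ?step (Running Ah) c'"
      by (meson id0_step.intros)
    with stuck Running show ?thesis by blast
  next
    case (Stopped A0 Ap)
    have "inv c"
      using that(1) by (induction rule: rtranclp_induct) (auto intro: start step_inv)
    with Stopped show ?thesis
      by (simp add: inv_def)
  qed
  ultimately show ?thesis
    by (simp add: id0_terminates_with_def)
qed

context regular_kkt_point
begin

section \<open>Identification near the solution set\<close>

lemma local_estimates:
  obtains K where "0 < K"
    "\<forall>\<^sub>F z in nhds zs. norm (grad \<phi> z - grad \<phi> zs) \<le> K * norm (z - zs)"
    "\<And>i. \<forall>\<^sub>F z in nhds zs. norm (a i z - a i zs) \<le> K * norm (z - zs)"
    "\<And>i. \<forall>\<^sub>F z in nhds zs. \<bar>g z $ i - g zs $ i\<bar> \<le> K * norm (z - zs)"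
    "\<forall>\<^sub>F z in nhds zs. \<forall>lam. lagr_z \<phi> g z lam = grad \<phi> z + (\<Sum>i\<in>UNIV. lam $ i *\<^sub>R a i z)"
proof -
  obtain K0 where K0: "0 \<le> K0" "\<forall>\<^sub>F z in nhds zs. norm (grad \<phi> z - grad \<phi> zs) \<le> K0 * norm (z - zs)"
    by (rule has_derivative_imp_local_lipschitz[OF grad_has_derivative(1)])
  have "\<forall>i. \<exists>K. 0 \<le> K \<and> (\<forall>\<^sub>F z in nhds zs. norm (a i z - a i zs) \<le> K * norm (z - zs))"
    by (rule allI, rule has_derivative_imp_local_lipschitz[OF grad_has_derivative(2)], rule exI, rule conjI)
  then obtain K1 where K1:
    "\<forall>i. 0 \<le> K1 i \<and> (\<forall>\<^sub>F z in nhds zs. norm (a i z - a i zs) \<le> K1 i * norm (z - zs))"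
    by (rule choice[THEN exE])
  have "\<forall>i. \<exists>K. 0 \<le> K \<and> (\<forall>\<^sub>F z in nhds zs. norm (g z $ i - g zs $ i) \<le> K * norm (z - zs))"
    by (rule allI, rule has_derivative_imp_local_lipschitz[OF constr_has_derivative], rule exI, rule conjI)
  then obtain K2 where K2:
    "\<forall>i. 0 \<le> K2 i \<and> (\<forall>\<^sub>F z in nhds zs. norm (g z $ i - g zs $ i) \<le> K2 i * norm (z - zs))"
    by (rule choice[THEN exE])
  \<comment> \<open>There are finitely many constraints, so summing the nonnegative constants gives
    a common one; the 1 makes it positive.\<close>
  let ?K = "K0 + (\<Sum>i\<in>UNIV. K1 i) + (\<Sum>i\<in>UNIV. K2 i) + 1"
  have s: "0 \<le> (\<Sum>i\<in>UNIV. K1 i)" "0 \<le> (\<Sum>i\<in>UNIV. K2 i)"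
    using K1 K2 by (auto intro: sum_nonneg)
  have K1': "K1 i \<le> (\<Sum>i\<in>UNIV. K1 i)" for i
    by (rule member_le_sum) (auto simp: K1)
  have K2': "K2 i \<le> (\<Sum>i\<in>UNIV. K2 i)" for i
    by (rule member_le_sum) (auto simp: K2)
  have up: "x \<le> ?K * norm (z - zs)" if "x \<le> C * norm (z - zs)" "C \<le> ?K" for x C z
    using that(1) mult_right_mono[OF that(2), of "norm (z - zs)"] by simp
  obtain U where U: "open U" "zs \<in> U"
    "\<And>z lam. z \<in> U \<Longrightarrow> lagr_z \<phi> g z lam = grad \<phi> z + (\<Sum>i\<in>UNIV. lam $ i *\<^sub>R a i z)"
    by (rule neighbourhood) blast
  show thesis
  proof
    show "0 < ?K" using s K0(1) by linarith
    show "\<forall>\<^sub>F z in nhds zs. norm (grad \<phi> z - grad \<phi> zs) \<le> ?K * norm (z - zs)"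
      using K0(2) by (rule eventually_mono) (rule up, assumption, use s K0(1) in linarith)
    show "\<forall>\<^sub>F z in nhds zs. norm (a i z - a i zs) \<le> ?K * norm (z - zs)" for i
      using K1[rule_format, of i, THEN conjunct2] by (rule eventually_mono) (rule up, assumption, use s K0(1) K1'[of i] in linarith)
    show "\<forall>\<^sub>F z in nhds zs. \<bar>g z $ i - g zs $ i\<bar> \<le> ?K * norm (z - zs)" for i
      using K2[rule_format, of i, THEN conjunct2] unfolding real_norm_def
      by (rule eventually_mono) (rule up, assumption, use s K0(1) K2'[of i] in linarith)
    show "\<forall>\<^sub>F z in nhds zs. \<forall>lam. lagr_z \<phi> g z lam = grad \<phi> z + (\<Sum>i\<in>UNIV. lam $ i *\<^sub>R a i z)"
      using eventually_nhds_in_open[OF U(1,2)] by (rule eventually_mono) (use U(3) in blast)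
  qed
qed

text \<open>Extended by zero, an exact solution of the stationarity system on the active set belongs
  to \<open>\<Lambda>\<close>, so its weakly active entries vanish. The dual certificate gives a
  constant for each such index, and their sum serves for all.\<close>

lemma weak_multiplier_bound:
  obtains C where "0 \<le> C" "\<And>l i. (\<And>j. j \<in> \<B> \<Longrightarrow> 0 \<le> l j) \<Longrightarrow> i \<in> \<B>0 \<Longrightarrow>
    l i \<le> C * norm (grad \<phi> zs + (\<Sum>j\<in>\<B>. l j *\<^sub>R a j zs))"
proof -
  obtain ls where ls: "ls \<in> \<Lambda>"
    using multipliers_nonempty by blast
  have "\<exists>C\<ge>0. \<forall>l. (\<forall>j\<in>\<B>. 0 \<le> l j) \<longrightarrow> l i \<le> C * norm (grad \<phi> zs + (\<Sum>j\<in>\<B>. l j *\<^sub>R a j zs))"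
    if i: "i \<in> \<B>0" for i
  proof -
    have "l i \<le> 0" if l: "\<And>j. j \<in> \<B> \<Longrightarrow> 0 \<le> l j" "grad \<phi> zs + (\<Sum>j\<in>\<B>. l j *\<^sub>R a j zs) = 0" for l
    proof -
      have "(\<chi> j. if j \<in> \<B> then l j else 0) \<in> \<Lambda>"
        using l by (auto simp: multiplier_iff)
      then show ?thesis
        using i by (force simp: weakly_active_def strongly_active_def not_less)
    qed
    note zero = this
    have "i \<in> \<B>"
      using i by (simp add: weakly_active_def)
    have sol: "\<And>j. j \<in> \<B> \<Longrightarrow> 0 \<le> ls $ j" "grad \<phi> zs + (\<Sum>j\<in>\<B>. ls $ j *\<^sub>R a j zs) = 0"
      using ls multiplier_iff by auto
    show ?thesis
    proof (rule vanishing_multiplier_bound[of \<B> i "($) ls" "grad \<phi> zs" "\<lambda>j. a j zs"])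
      show "0 \<le> ls $ j" if "j \<in> \<B>" for j
        using that by (rule sol(1))
      show "l i \<le> 0" if "\<And>j. j \<in> \<B> \<Longrightarrow> 0 \<le> l j" "grad \<phi> zs + (\<Sum>j\<in>\<B>. l j *\<^sub>R a j zs) = 0" for l
        using that by (rule zero)
      show ?thesis if "0 \<le> C"
        "\<And>l. (\<And>j. j \<in> \<B> \<Longrightarrow> 0 \<le> l j) \<Longrightarrow> l i \<le> C * norm (grad \<phi> zs + (\<Sum>j\<in>\<B>. l j *\<^sub>R a j zs))" for C
        using that by (intro exI[of _ C]) blast
    qed (use \<open>i \<in> \<B>\<close> sol(2) in simp_all)
  qed
  then have "\<forall>i\<in>\<B>0. \<exists>C. 0 \<le> C \<and>
      (\<forall>l. (\<forall>j\<in>\<B>. 0 \<le> l j) \<longrightarrow> l i \<le> C * norm (grad \<phi> zs + (\<Sum>j\<in>\<B>. l j *\<^sub>R a j zs)))"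
    by blast
  then obtain C where "\<forall>i\<in>\<B>0. 0 \<le> C i \<and>
      (\<forall>l. (\<forall>j\<in>\<B>. 0 \<le> l j) \<longrightarrow> l i \<le> C i * norm (grad \<phi> zs + (\<Sum>j\<in>\<B>. l j *\<^sub>R a j zs)))"
    by (rule bchoice[THEN exE])
  then have C: "0 \<le> C i"
    "\<And>l. (\<forall>j\<in>\<B>. 0 \<le> l j) \<Longrightarrow> l i \<le> C i * norm (grad \<phi> zs + (\<Sum>j\<in>\<B>. l j *\<^sub>R a j zs))"
    if "i \<in> \<B>0" for i
    using that by blast+
  show thesis
  proof
    show "0 \<le> (\<Sum>i\<in>\<B>0. C i)"
      using C(1) by (rule sum_nonneg)
    fix l :: "'m \<Rightarrow> real" and i assume l: "\<And>j. j \<in> \<B> \<Longrightarrow> 0 \<le> l j" and i: "i \<in> \<B>0"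
    have "l i \<le> C i * norm (grad \<phi> zs + (\<Sum>j\<in>\<B>. l j *\<^sub>R a j zs))"
      using l by (intro C(2)[OF i]) blast
    also have "\<dots> \<le> (\<Sum>i\<in>\<B>0. C i) * norm (grad \<phi> zs + (\<Sum>j\<in>\<B>. l j *\<^sub>R a j zs))"
      by (intro mult_right_mono member_le_sum) (auto simp: i C(1))
    finally show "l i \<le> (\<Sum>i\<in>\<B>0. C i) * norm (grad \<phi> zs + (\<Sum>j\<in>\<B>. l j *\<^sub>R a j zs))" .
  qed
qed

text \<open>Moving the gradients from \<open>zs\<close> to \<open>z\<close> changes the stationarity
  residual by at most \<open>K * d * (1 + s)\<close>, with \<open>s\<close> the sum of the
  multipliers. For small \<open>d\<close> the term in \<open>s\<close> is absorbed in the MFCQ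
  bound; once \<open>s\<close> is bounded, the weak multiplier bound carries over.\<close>

lemma perturbed_multiplier_bounds:
  obtains C where "0 < C" "\<forall>\<^sub>F z in nhds zs. \<forall>l. (\<forall>j\<in>\<B>. 0 \<le> l j) \<longrightarrow>
      norm (grad \<phi> z + (\<Sum>j\<in>\<B>. l j *\<^sub>R a j z)) \<le> 1 \<longrightarrow>
      (\<Sum>j\<in>\<B>. l j) \<le> C \<and>
      (\<forall>i\<in>\<B>0. l i \<le> C * (norm (grad \<phi> z + (\<Sum>j\<in>\<B>. l j *\<^sub>R a j z)) + norm (z - zs)))"
proof -
  obtain M where M: "0 < M"
    "\<And>l. (\<And>i. i \<in> \<B> \<Longrightarrow> 0 \<le> l i) \<Longrightarrow> (\<Sum>i\<in>\<B>. l i) \<le> M * norm (\<Sum>i\<in>\<B>. l i *\<^sub>R a i zs)"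
    by (rule active_multiplier_bound) (rule that, assumption, blast)
  obtain W where W: "0 \<le> W" "\<And>l i. (\<And>j. j \<in> \<B> \<Longrightarrow> 0 \<le> l j) \<Longrightarrow> i \<in> \<B>0 \<Longrightarrow>
    l i \<le> W * norm (grad \<phi> zs + (\<Sum>j\<in>\<B>. l j *\<^sub>R a j zs))"
    by (rule weak_multiplier_bound) (rule that, assumption, blast)
  obtain K where K: "0 < K"
    "\<forall>\<^sub>F z in nhds zs. norm (grad \<phi> z - grad \<phi> zs) \<le> K * norm (z - zs)"
    "\<And>i. \<forall>\<^sub>F z in nhds zs. norm (a i z - a i zs) \<le> K * norm (z - zs)"
    by (rule local_estimates) (rule that)
  have K3: "\<forall>\<^sub>F z in nhds zs. \<forall>i\<in>UNIV. norm (a i z - a i zs) \<le> K * norm (z - zs)"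
    using K(3) by (intro eventually_ball_finite) auto
  have lim: "((\<lambda>z. K * norm (z - zs)) \<longlongrightarrow> 0) (nhds zs)"
    by (rule tendsto_eq_intros filterlim_ident refl | simp)+
  \<comment> \<open>The radius makes the coefficient \<open>M * K * d\<close> of \<open>s\<close> at
    most 1/2, so that it can be absorbed.\<close>
  have small: "\<forall>\<^sub>F z in nhds zs. K * norm (z - zs) < min 1 (1 / (2 * M))"
    using M(1) by (intro order_tendstoD(2)[OF lim]) auto
  \<comment> \<open>The inner 2 covers \<open>norm r \<le> 1\<close> and
    \<open>K * d \<le> 1\<close>; the outer 2 is the price of the absorption.\<close>
  define S where "S = 2 * M * (2 + norm (grad \<phi> zs))"
  have S: "0 < S"
    unfolding S_def using M(1) by (intro mult_pos_pos add_pos_nonneg) auto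
  define C where "C = S + W * (1 + K * (1 + S))"
  have C: "S \<le> C" "W \<le> C" "W * (K * (1 + S)) \<le> C" "0 < C"
  proof -
    have "0 \<le> W * (K * (1 + S))"
      using W(1) K(1) S by simp
    then show "S \<le> C" "W \<le> C" "W * (K * (1 + S)) \<le> C" "0 < C"
      using W(1) S by (auto simp: C_def distrib_left[of W])
  qed
  show thesis
  proof
    show "0 < C" by (rule C)
    show "\<forall>\<^sub>F z in nhds zs. \<forall>l. (\<forall>j\<in>\<B>. 0 \<le> l j) \<longrightarrow>
      norm (grad \<phi> z + (\<Sum>j\<in>\<B>. l j *\<^sub>R a j z)) \<le> 1 \<longrightarrow>
      (\<Sum>j\<in>\<B>. l j) \<le> C \<and>
      (\<forall>i\<in>\<B>0. l i \<le> C * (norm (grad \<phi> z + (\<Sum>j\<in>\<B>. l j *\<^sub>R a j z)) + norm (z - zs)))"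
      using K(2) K3 small
    proof eventually_elim
      case (elim z)
      show ?case
      proof (intro allI impI)
        fix l :: "'m \<Rightarrow> real" assume l: "\<forall>j\<in>\<B>. 0 \<le> l j" and r1: "norm (grad \<phi> z + (\<Sum>j\<in>\<B>. l j *\<^sub>R a j z)) \<le> 1"
        define r where "r = grad \<phi> z + (\<Sum>j\<in>\<B>. l j *\<^sub>R a j z)"
        define d where "d = norm (z - zs)"
        define s where "s = (\<Sum>j\<in>\<B>. l j)"
        have r: "norm r \<le> 1"
          using r1 by (simp add: r_def)
        have s: "0 \<le> s"
          unfolding s_def using l by (intro sum_nonneg) auto
        have d: "0 \<le> d" "K * d \<le> 1" "M * (K * d) \<le> 1 / 2"
          using elim(3) M(1) by (auto simp: d_def field_simps)
        have pert: "norm (\<Sum>j\<in>\<B>. l j *\<^sub>R (a j z - a j zs)) \<le> K * d * s"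
        proof -
          have "norm (\<Sum>j\<in>\<B>. l j *\<^sub>R (a j z - a j zs)) \<le> (\<Sum>j\<in>\<B>. l j * (K * d))"
            using l elim(2) by (intro sum_norm_le) (simp add: d_def mult_left_mono)
          also have "\<dots> = K * d * s"
            unfolding s_def by (simp only: sum_distrib_left mult.commute)
          finally show ?thesis .
        qed
        have eq: "grad \<phi> zs + (\<Sum>j\<in>\<B>. l j *\<^sub>R a j zs) =
            r - (grad \<phi> z - grad \<phi> zs) - (\<Sum>j\<in>\<B>. l j *\<^sub>R (a j z - a j zs))"
          by (simp add: r_def scaleR_diff_right sum_subtractf)
        have rs: "norm (grad \<phi> zs + (\<Sum>j\<in>\<B>. l j *\<^sub>R a j zs)) \<le> norm r + K * d + K * d * s"
        proof -
          have "norm (r - x - y) \<le> norm r + norm x + norm y" for x y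
            using norm_triangle_ineq4[of "r - x" y] norm_triangle_ineq4[of r x] by linarith
          from this[of "grad \<phi> z - grad \<phi> zs" "\<Sum>j\<in>\<B>. l j *\<^sub>R (a j z - a j zs)"] pert elim(1)
          show ?thesis
            unfolding eq d_def by linarith
        qed
        have "s \<le> M * norm (\<Sum>j\<in>\<B>. l j *\<^sub>R a j zs)"
          unfolding s_def using l by (intro M(2)) auto
        also have "\<dots> \<le> M * (2 + norm (grad \<phi> zs) + K * d * s)"
        proof (rule mult_left_mono)
          have "norm (\<Sum>j\<in>\<B>. l j *\<^sub>R a j zs) \<le>
              norm (grad \<phi> zs + (\<Sum>j\<in>\<B>. l j *\<^sub>R a j zs)) + norm (grad \<phi> zs)"
            using norm_triangle_ineq4[of "grad \<phi> zs + (\<Sum>j\<in>\<B>. l j *\<^sub>R a j zs)" "grad \<phi> zs"] by simp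
          with rs r d(2) show "norm (\<Sum>j\<in>\<B>. l j *\<^sub>R a j zs) \<le> 2 + norm (grad \<phi> zs) + K * d * s"
            by linarith
        qed (use M(1) in simp)
        also have "\<dots> = S / 2 + M * (K * d) * s"
          by (simp add: S_def algebra_simps)
        also have "\<dots> \<le> S / 2 + 1 / 2 * s"
          using mult_right_mono[OF d(3) s] by simp
        finally have sS: "s \<le> S"
          by simp
        have "l i \<le> C * (norm r + d)" if "i \<in> \<B>0" for i
        proof -
          have "l i \<le> W * norm (grad \<phi> zs + (\<Sum>j\<in>\<B>. l j *\<^sub>R a j zs))"
            using l that by (intro W(2)) auto
          also have "\<dots> \<le> W * (norm r + K * d + K * d * S)"
          proof (rule mult_left_mono)
            have "K * d * s \<le> K * d * S"
              using K(1) d(1) by (intro mult_left_mono sS) simp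
            with rs show "norm (grad \<phi> zs + (\<Sum>j\<in>\<B>. l j *\<^sub>R a j zs)) \<le> norm r + K * d + K * d * S"
              by linarith
          qed (rule W(1))
          also have "\<dots> = W * norm r + W * (K * (1 + S)) * d"
            by (simp add: algebra_simps)
          also have "\<dots> \<le> C * norm r + C * d"
            using C d(1) by (intro add_mono mult_right_mono) auto
          finally show ?thesis
            by (simp add: distrib_left)
        qed
        with sS C(1) show "(\<Sum>j\<in>\<B>. l j) \<le> C \<and>
          (\<forall>i\<in>\<B>0. l i \<le> C * (norm (grad \<phi> z + (\<Sum>j\<in>\<B>. l j *\<^sub>R a j z)) + norm (z - zs)))"
          by (simp add: s_def r_def d_def)
      qed
    qed
  qed
qed

text \<open>\<open>\<delta>(z, \<lambda>) \<rightarrow> 0\<close> as a filter.\<close>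

definition near :: "((real^'n) \<times> (real^'m)) filter" where
  "near = filtercomap (\<lambda>p. kkt_dist \<phi> g zs (fst p) (snd p)) (nhds 0)"

lemma kkt_dist_nonneg: "0 \<le> kkt_dist \<phi> g zs z lam"
  by (simp add: kkt_dist_def infdist_nonneg)

text \<open>Translates between the filter, which lets finitely many smallness conditions be
  combined, and a single radius as in the final statement.\<close>

lemma eventually_near_iff:
  "eventually P near \<longleftrightarrow> (\<exists>\<delta>>0. \<forall>z lam. kkt_dist \<phi> g zs z lam \<le> \<delta> \<longrightarrow> P (z, lam))"
proof
  assume "eventually P near"
  then obtain Q where Q: "eventually Q (nhds (0::real))"
    "\<And>p. Q (kkt_dist \<phi> g zs (fst p) (snd p)) \<Longrightarrow> P p"
    unfolding near_def eventually_filtercomap by blast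
  then obtain d where d: "d > 0" "\<And>x. dist x 0 < d \<Longrightarrow> Q x"
    unfolding eventually_nhds_metric by blast
  have "P (z, lam)" if "kkt_dist \<phi> g zs z lam \<le> d / 2" for z lam
    using Q(2)[of "(z, lam)"] d that kkt_dist_nonneg[of z lam] by simp
  with d(1) show "\<exists>\<delta>>0. \<forall>z lam. kkt_dist \<phi> g zs z lam \<le> \<delta> \<longrightarrow> P (z, lam)"
    by (intro exI[of _ "d / 2"]) simp
next
  assume "\<exists>\<delta>>0. \<forall>z lam. kkt_dist \<phi> g zs z lam \<le> \<delta> \<longrightarrow> P (z, lam)"
  then obtain \<delta> where \<delta>: "\<delta> > 0" "\<And>z lam. kkt_dist \<phi> g zs z lam \<le> \<delta> \<Longrightarrow> P (z, lam)"
    by blast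
  have "eventually (\<lambda>x. x < \<delta>) (nhds (0::real))"
    using \<delta>(1) by (rule eventually_nhds_in_open[OF open_lessThan, of 0 \<delta>, simplified])
  then show "eventually P near"
    unfolding near_def eventually_filtercomap
    by (intro exI[of _ "\<lambda>x. x < \<delta>"] conjI allI impI) (auto intro: \<delta>(2))
qed

lemma dist_near: "((\<lambda>p. kkt_dist \<phi> g zs (fst p) (snd p)) \<longlongrightarrow> 0) near"
  unfolding near_def by (rule filterlim_filtercomap)

lemma fst_near: "filterlim fst (nhds zs) near"
proof (rule LIM_zero_cancel, rule Lim_null_comparison[OF _ dist_near], rule always_eventually, rule allI)
  fix p :: "(real^'n) \<times> (real^'m)"
  show "norm (fst p - zs) \<le> kkt_dist \<phi> g zs (fst p) (snd p)"
    by (rule kkt_dist_attained)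
qed

text \<open>The residual is 0 at a nearest exact pair. Comparison with that pair bounds it by a
  polynomial in the distance without constant term.\<close>

lemma residual_near: "((\<lambda>p. \<eta> (fst p) (snd p)) \<longlongrightarrow> 0) near"
proof -
  obtain K where K: "0 < K"
    "\<forall>\<^sub>F z in nhds zs. norm (grad \<phi> z - grad \<phi> zs) \<le> K * norm (z - zs)"
    "\<And>i. \<forall>\<^sub>F z in nhds zs. norm (a i z - a i zs) \<le> K * norm (z - zs)"
    "\<And>i. \<forall>\<^sub>F z in nhds zs. \<bar>g z $ i - g zs $ i\<bar> \<le> K * norm (z - zs)"
    "\<forall>\<^sub>F z in nhds zs. \<forall>lam. lagr_z \<phi> g z lam = grad \<phi> z + (\<Sum>i\<in>UNIV. lam $ i *\<^sub>R a i z)"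
    by (rule local_estimates) (rule that)
  obtain M where M: "0 < M" "\<And>lam i. lam \<in> \<Lambda> \<Longrightarrow> \<bar>lam $ i\<bar> \<le> M"
    by (rule multipliers_bounded) (rule that)
  let ?d = "\<lambda>p. kkt_dist \<phi> g zs (fst p) (snd p)"
  \<comment> \<open>The terms account for the change of \<open>grad \<phi>\<close>, for the moved
    constraint gradients with multipliers of size at most \<open>M + d\<close>, for the displaced
    multipliers, and for complementarity.\<close>
  let ?e = "\<lambda>d. K * d + (\<Sum>i\<in>UNIV. (M + d) * (K * d) + d * norm (a i zs)) + (\<Sum>i\<in>(UNIV::'m set). d + K * d)"
  have "\<forall>\<^sub>F z in nhds zs. \<forall>i\<in>UNIV. norm (a i z - a i zs) \<le> K * norm (z - zs)"
    "\<forall>\<^sub>F z in nhds zs. \<forall>i\<in>UNIV. \<bar>g z $ i - g zs $ i\<bar> \<le> K * norm (z - zs)"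
    using K(3,4) by (intro eventually_ball_finite; simp)+
  with K(2,5) have "\<forall>\<^sub>F z in nhds zs. norm (grad \<phi> z - grad \<phi> zs) \<le> K * norm (z - zs) \<and>
      (\<forall>i. norm (a i z - a i zs) \<le> K * norm (z - zs)) \<and>
      (\<forall>i. \<bar>g z $ i - g zs $ i\<bar> \<le> K * norm (z - zs)) \<and>
      (\<forall>lam. lagr_z \<phi> g z lam = grad \<phi> z + (\<Sum>i\<in>UNIV. lam $ i *\<^sub>R a i z))"
    by eventually_elim simp
  then have "\<forall>\<^sub>F p in near. norm (grad \<phi> (fst p) - grad \<phi> zs) \<le> K * norm (fst p - zs) \<and>
      (\<forall>i. norm (a i (fst p) - a i zs) \<le> K * norm (fst p - zs)) \<and>
      (\<forall>i. \<bar>g (fst p) $ i - g zs $ i\<bar> \<le> K * norm (fst p - zs)) \<and>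
      (\<forall>lam. lagr_z \<phi> g (fst p) lam = grad \<phi> (fst p) + (\<Sum>i\<in>UNIV. lam $ i *\<^sub>R a i (fst p)))"
    by (rule eventually_compose_filterlim[OF _ fst_near])
  then have le: "\<forall>\<^sub>F p in near. \<eta> (fst p) (snd p) \<le> ?e (?d p)"
  proof eventually_elim
    case (elim p)
    define z lam d where "z = fst p" and "lam = snd p" and "d = kkt_dist \<phi> g zs z lam"
    note e = elim[folded z_def]
    obtain ls where ls: "ls \<in> \<Lambda>" "norm (z - zs) \<le> d" "norm (lam - ls) \<le> d"
      unfolding d_def by (rule kkt_dist_attained)
    have d: "0 \<le> d"
      by (simp add: d_def kkt_dist_nonneg)
    have Kd: "K * norm (z - zs) \<le> K * d"
      using K(1) ls(2) by simp
    have li: "\<bar>lam $ i - ls $ i\<bar> \<le> d" for i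
      using component_le_norm_cart[of "lam - ls" i] ls(3) by simp
    have lam: "\<bar>lam $ i\<bar> \<le> M + d" for i
      using li[of i] M(2)[OF ls(1), of i] by linarith
    have "lagr_z \<phi> g zs ls = 0"
      using ls(1) by (simp add: kkt_multipliers_def)
    then have "lagr_z \<phi> g z lam = lagr_z \<phi> g z lam - lagr_z \<phi> g zs ls"
      by simp
    also have "\<dots> = (grad \<phi> z - grad \<phi> zs) +
        (\<Sum>i\<in>UNIV. lam $ i *\<^sub>R (a i z - a i zs) + (lam $ i - ls $ i) *\<^sub>R a i zs)"
      using e by (simp add: lagr_z_zs algebra_simps sum.distrib sum_subtractf)
    also have "norm \<dots> \<le> K * d + (\<Sum>i\<in>UNIV. (M + d) * (K * d) + d * norm (a i zs))"
    proof (rule norm_triangle_mono)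
      show "norm (grad \<phi> z - grad \<phi> zs) \<le> K * d"
        using e Kd by linarith
      show "norm (\<Sum>i\<in>UNIV. lam $ i *\<^sub>R (a i z - a i zs) + (lam $ i - ls $ i) *\<^sub>R a i zs)
          \<le> (\<Sum>i\<in>UNIV. (M + d) * (K * d) + d * norm (a i zs))"
      proof (rule sum_norm_le, rule norm_triangle_mono)
        fix i
        have "norm (a i z - a i zs) \<le> K * d"
          using e Kd by (meson order_trans)
        then show "norm (lam $ i *\<^sub>R (a i z - a i zs)) \<le> (M + d) * (K * d)"
          using lam[of i] M(1) d by (simp add: mult_mono)
        show "norm ((lam $ i - ls $ i) *\<^sub>R a i zs) \<le> d * norm (a i zs)"
          using li[of i] by (simp add: mult_right_mono)
      qed
    qed
    finally have lz: "norm (lagr_z \<phi> g z lam) \<le> K * d + (\<Sum>i\<in>UNIV. (M + d) * (K * d) + d * norm (a i zs))" .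
    have "\<bar>min (lam $ i) (- g z $ i)\<bar> \<le> d + K * d" for i
    proof -
      have "0 \<le> ls $ i" "i \<notin> \<B> \<Longrightarrow> ls $ i = 0"
        using multiplier_iff[of ls] ls(1) by auto
      then have "min (ls $ i) (- g zs $ i) = 0"
        using zs_feasible[of i] by (cases "i \<in> \<B>") (auto simp: active_def)
      moreover have "\<bar>g z $ i - g zs $ i\<bar> \<le> K * d"
        using e Kd by (meson order_trans)
      ultimately show ?thesis
        using li[of i] unfolding min_def by (auto split: if_splits)
    qed
    then have "(\<Sum>i\<in>UNIV. \<bar>min (lam $ i) (- g z $ i)\<bar>) \<le> (\<Sum>i\<in>(UNIV::'m set). d + K * d)"
      by (rule sum_mono)
    with lz residual_le_sum[of z lam] show ?case
      unfolding z_def[symmetric] lam_def[symmetric] d_def[symmetric] by linarith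
  qed
  have "((\<lambda>p. ?e (?d p)) \<longlongrightarrow> K * 0 + (\<Sum>i\<in>UNIV. (M + 0) * (K * 0) + 0 * norm (a i zs)) + (\<Sum>i\<in>(UNIV::'m set). 0 + K * 0)) near"
    by (intro tendsto_intros dist_near)
  then have "((\<lambda>p. ?e (?d p)) \<longlongrightarrow> 0) near"
    by simp
  from tendsto_sandwich[OF always_eventually le tendsto_const this] show ?thesis
    by (simp add: residual_nonneg)
qed

text \<open>Together with the error bound this shows that near the solution set the residual
  vanishes only on the set itself.\<close>

lemma kkt_set_if_residual_0:
  assumes "\<eta> zs lam = 0"
  shows "(zs, lam) \<in> kkt_set \<phi> g zs"
proof -
  have m: "min (lam $ i) (- g zs $ i) = 0" for i
    using compl_le_residual[of lam i zs] assms by simp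
  have "0 \<le> lam $ i \<and> lam $ i * g zs $ i = 0" for i
    using m[of i] by (auto simp: min_def split: if_splits)
  moreover have "lagr_z \<phi> g zs lam = 0"
    using lagr_z_le_residual[of zs lam] assms by simp
  moreover from calculation(1) have "lam \<bullet> g zs = 0"
    unfolding inner_vec_def by (intro sum.neutral) simp
  ultimately show ?thesis
    using zs_feasible by (auto simp: kkt_set_def kkt_multipliers_def less_eq_vec_def)
qed

text \<open>The factor 2 leaves one \<open>\<gamma>\<close> for the change of \<open>g\<close> and
  one for the residual and its power.\<close>

lemma inactive_gap:
  obtains \<gamma> where "0 < \<gamma>" "\<And>i. i \<notin> \<B> \<Longrightarrow> g zs $ i \<le> - 2 * \<gamma>"
proof (cases "- \<B> = {}")
  case True
  then show ?thesis by (intro that[of 1]) auto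
next
  case False
  have neg: "g zs $ i < 0" if "i \<in> - \<B>" for i
    using that zs_feasible[of i] by (simp add: active_def)
  show ?thesis
  proof
    show "0 < Min ((\<lambda>i. - g zs $ i / 2) ` (- \<B>))"
      using False neg by (subst Min_gr_iff) auto
    fix i assume "i \<notin> \<B>"
    then have "Min ((\<lambda>i. - g zs $ i / 2) ` (- \<B>)) \<le> - g zs $ i / 2"
      by (intro Min_le) auto
    then show "g zs $ i \<le> - 2 * Min ((\<lambda>i. - g zs $ i / 2) ` (- \<B>))"
      by simp
  qed
qed

text \<open>Each index may have its own multiplier; this is enough because an optimal value
  dominates the value at every exact multiplier.\<close>

lemma strong_multiplier_gap:
  obtains c where "0 < c" "\<And>i. i \<in> \<B>p \<Longrightarrow> \<exists>ls\<in>\<Lambda>. c \<le> ls $ i"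
proof (cases "\<B>p = {}")
  case True
  then show ?thesis by (intro that[of 1]) auto
next
  case False
  have "\<forall>i\<in>\<B>p. \<exists>ls. ls \<in> \<Lambda> \<and> 0 < ls $ i"
    by (auto simp: strongly_active_def)
  then obtain f where f: "\<forall>i\<in>\<B>p. f i \<in> \<Lambda> \<and> 0 < f i $ i"
    by (rule bchoice[THEN exE])
  show ?thesis
  proof
    show "0 < Min ((\<lambda>i. f i $ i) ` \<B>p)"
      using False f by (subst Min_gr_iff) auto
    show "\<exists>ls\<in>\<Lambda>. Min ((\<lambda>i. f i $ i) ` \<B>p) \<le> ls $ i" if "i \<in> \<B>p" for i
      using that f by (intro bexI[of _ "f i"] Min_le) auto
  qed
qed

lemma eventually_id0_identifies:
  assumes "0 < \<tau>h" "\<tau>h < \<tau>" "\<tau> < 1"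
  shows "\<forall>\<^sub>F p in near. p \<notin> kkt_set \<phi> g zs \<or> \<B>0 = {} \<longrightarrow>
    id0_terminates_with \<phi> g \<tau>h \<tau> (fst p) (snd p) \<B>0 \<B>p"
proof -
  obtain K where K: "0 < K"
    "\<forall>\<^sub>F z in nhds zs. norm (grad \<phi> z - grad \<phi> zs) \<le> K * norm (z - zs)"
    "\<And>i. \<forall>\<^sub>F z in nhds zs. norm (a i z - a i zs) \<le> K * norm (z - zs)"
    "\<And>i. \<forall>\<^sub>F z in nhds zs. \<bar>g z $ i - g zs $ i\<bar> \<le> K * norm (z - zs)"
    "\<forall>\<^sub>F z in nhds zs. \<forall>lam. lagr_z \<phi> g z lam = grad \<phi> z + (\<Sum>i\<in>UNIV. lam $ i *\<^sub>R a i z)"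
    by (rule local_estimates) (rule that)
  obtain M where M: "0 < M" "\<And>lam i. lam \<in> \<Lambda> \<Longrightarrow> \<bar>lam $ i\<bar> \<le> M"
    by (rule multipliers_bounded) (rule that)
  obtain C where C: "0 < C" "\<forall>\<^sub>F z in nhds zs. \<forall>l. (\<forall>j\<in>\<B>. 0 \<le> l j) \<longrightarrow>
      norm (grad \<phi> z + (\<Sum>j\<in>\<B>. l j *\<^sub>R a j z)) \<le> 1 \<longrightarrow>
      (\<Sum>j\<in>\<B>. l j) \<le> C \<and>
      (\<forall>i\<in>\<B>0. l i \<le> C * (norm (grad \<phi> z + (\<Sum>j\<in>\<B>. l j *\<^sub>R a j z)) + norm (z - zs)))"
    by (rule perturbed_multiplier_bounds)
  obtain E \<delta> where E: "0 < E" "0 < \<delta>"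
    "\<And>z lam. kkt_dist \<phi> g zs z lam \<le> \<delta> \<Longrightarrow> norm (z - zs) \<le> E * \<eta> z lam"
    by (rule error_bound) (rule that)
  obtain \<gamma> where \<gamma>: "0 < \<gamma>" "\<And>i. i \<notin> \<B> \<Longrightarrow> g zs $ i \<le> - 2 * \<gamma>"
    by (rule inactive_gap) (rule that)
  obtain c where c: "0 < c" "\<And>i. i \<in> \<B>p \<Longrightarrow> \<exists>ls\<in>\<Lambda>. c \<le> ls $ i"
    by (rule strong_multiplier_gap) (rule that)
  \<comment> \<open>\<open>m\<close> bounds the size of every index set, \<open>n\<close> turns the
    componentwise constraints into a norm bound, and \<open>N\<close> bounds the sum of the norms of
    nearby constraint gradients.\<close>
  define m where "m = real CARD('m)"
  define n where "n = real CARD('n)"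
  define N where "N = (\<Sum>i\<in>(UNIV::'m set). norm (a i zs) + 1)"
  have N: "0 \<le> N"
    unfolding N_def by (intro sum_nonneg) simp

  have lim: "((\<lambda>z. K * norm (z - zs)) \<longlongrightarrow> 0) (nhds zs)"
    by (rule tendsto_eq_intros filterlim_ident refl | simp)+
  have est0: "\<forall>\<^sub>F z in nhds zs. K * norm (z - zs) < min 1 \<gamma>"
    using \<gamma>(1) by (intro order_tendstoD(2)[OF lim]) auto
  have est1: "\<forall>\<^sub>F z in nhds zs. \<forall>i\<in>UNIV. norm (a i z - a i zs) \<le> K * norm (z - zs)"
    "\<forall>\<^sub>F z in nhds zs. \<forall>i\<in>UNIV. \<bar>g z $ i - g zs $ i\<bar> \<le> K * norm (z - zs)"
    using K(3,4) by (intro eventually_ball_finite; simp)+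
  note est = est0[THEN eventually_compose_filterlim[OF _ fst_near]]
    est1[THEN eventually_compose_filterlim[OF _ fst_near]]
    K(2,5)[THEN eventually_compose_filterlim[OF _ fst_near]]
    C(2)[THEN eventually_compose_filterlim[OF _ fst_near]]

  have err: "\<forall>\<^sub>F p in near. norm (fst p - zs) \<le> E * \<eta> (fst p) (snd p)"
    unfolding eventually_near_iff using E(2,3) by auto

  have powr0: "((\<lambda>p. \<eta> (fst p) (snd p) powr q) \<longlongrightarrow> 0) near" if "0 < q" for q
    using that by (intro tendsto_zero_powrI[OF residual_near tendsto_const]) (simp_all add: residual_nonneg)
  have "0 < \<tau>"
    using assms by simp
  have "((\<lambda>p. \<eta> (fst p) (snd p) + \<eta> (fst p) (snd p) powr \<tau>) \<longlongrightarrow> 0 + 0) near"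
    by (intro tendsto_add residual_near powr0 \<open>0 < \<tau>\<close>)
  then have s1: "\<forall>\<^sub>F p in near. \<eta> (fst p) (snd p) + \<eta> (fst p) (snd p) powr \<tau> < \<gamma>"
    using \<gamma>(1) by (intro order_tendstoD(2)) auto
  have "((\<lambda>p. n * \<eta> (fst p) (snd p) powr \<tau> + (1 + N) * \<eta> (fst p) (snd p)) \<longlongrightarrow> n * 0 + (1 + N) * 0) near"
    by (intro tendsto_intros residual_near powr0 \<open>0 < \<tau>\<close>)
  \<comment> \<open>Keeps the stationarity violation below 1, as the perturbed bounds require, both
    for feasible points of the linear program and for the truncation of \<open>lam\<close>
    below.\<close>
  then have s2: "\<forall>\<^sub>F p in near. n * \<eta> (fst p) (snd p) powr \<tau> + (1 + N) * \<eta> (fst p) (snd p) < 1"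
    by (intro order_tendstoD(2)) auto
  have "((\<lambda>p. m * \<eta> (fst p) (snd p) powr \<tau>h) \<longlongrightarrow> m * 0) near"
    by (intro tendsto_intros powr0 assms)
  then have s3: "\<forall>\<^sub>F p in near. m * \<eta> (fst p) (snd p) powr \<tau>h < c"
    using c(1) by (intro order_tendstoD(2)) auto
  have s4: "\<forall>\<^sub>F p in near. 0 < \<eta> (fst p) (snd p) \<longrightarrow>
      K * (1 + m * M) * E * \<eta> (fst p) (snd p) powr 1 < \<eta> (fst p) (snd p) powr \<tau>"
    using powr_eventually_dominated[OF assms(3)] by (rule eventually_compose_filterlim[OF _ residual_near])
  \<comment> \<open>The factor 2 here and in \<open>s6\<close> gives each of the two contributions
    to a weakly active entry half of the threshold.\<close>
  have s5: "\<forall>\<^sub>F p in near. 0 < \<eta> (fst p) (snd p) \<longrightarrow>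
      2 * C * n * \<eta> (fst p) (snd p) powr \<tau> < \<eta> (fst p) (snd p) powr \<tau>h"
    using powr_eventually_dominated[OF assms(2)] by (rule eventually_compose_filterlim[OF _ residual_near])
  have "\<tau>h < 1"
    using assms by simp
  then have s6: "\<forall>\<^sub>F p in near. 0 < \<eta> (fst p) (snd p) \<longrightarrow>
      2 * C * (1 + N + E) * \<eta> (fst p) (snd p) powr 1 < \<eta> (fst p) (snd p) powr \<tau>h"
    by (rule eventually_compose_filterlim[OF powr_eventually_dominated residual_near])

  show ?thesis
    using est err s1 s2 s3 s4 s5 s6
  proof eventually_elim
    case (elim p)
    define z lam x d where "z = fst p" and "lam = snd p" and "x = \<eta> z lam" and "d = norm (z - zs)"
    note e = elim[folded z_def lam_def, folded x_def d_def]
    have x: "0 \<le> x"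
      by (simp add: x_def residual_nonneg)
    have d: "0 \<le> d" "d \<le> E * x"
      using e(7) by (simp_all add: d_def)
    have lagr: "lagr_z \<phi> g z lam = grad \<phi> z + (\<Sum>i\<in>UNIV. lam $ i *\<^sub>R a i z)"
      using e(5) by blast
    have az: "norm (a i z - a i zs) \<le> K * d" for i
      using e(2) by blast
    have gz: "\<bar>g z $ i - g zs $ i\<bar> \<le> K * d" for i
      using e(3) by blast
    have mM: "0 \<le> m * M"
      using M(1) by (simp add: m_def)
    \<comment> \<open>The error bound enters here: \<open>d\<close> is \<open>O(x)\<close>, hence
      negligible against the threshold. If \<open>x = 0\<close>, then \<open>d = 0\<close>
      too.\<close>
    have thr: "K * (1 + m * M) * d \<le> x powr \<tau>"
    proof (cases "x = 0")
      case False
      have "K * (1 + m * M) * d \<le> K * (1 + m * M) * (E * x)"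
        using d(2) K(1) mM by (intro mult_left_mono) auto
      also have "\<dots> \<le> x powr \<tau>"
        using e(11) x False by (simp add: mult.assoc)
      finally show ?thesis .
    qed (use d in simp)
    have "K * d \<le> K * (1 + m * M) * d"
      using K(1) mM d(1) by (intro mult_right_mono) auto
    with thr have Kd: "K * d \<le> x powr \<tau>"
      by linarith

    have act: "active_est \<phi> g \<tau> z lam = \<B>"
    proof (intro equalityI subsetI)
      fix i assume "i \<in> active_est \<phi> g \<tau> z lam"
      then have "- (x powr \<tau>) \<le> g z $ i"
        by (simp add: active_est_def x_def)
      then show "i \<in> \<B>"
        using \<gamma>(2)[of i] gz[of i] e(1) e(8) x by (intro ccontr[of "i \<in> \<B>"]) (simp; linarith)
    next
      fix i assume "i \<in> \<B>"
      then show "i \<in> active_est \<phi> g \<tau> z lam"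
        using gz[of i] Kd by (simp add: active_est_def active_def x_def)
    qed

    have feas_bound: "(\<Sum>j\<in>\<B>. \<mu> $ j) \<le> C"
      "i \<in> \<B>0 \<Longrightarrow> 0 < x \<Longrightarrow> \<mu> $ i < x powr \<tau>h"
      "0 \<le> \<mu> $ j" "j \<notin> \<B> \<Longrightarrow> \<mu> $ j = 0"
      if "id0_feasible \<phi> g \<tau> z lam \<mu>" for \<mu> i j
    proof -
      define r where "r = grad \<phi> z + (\<Sum>i\<in>\<B>. \<mu> $ i *\<^sub>R a i z)"
      have feas: "\<And>j. \<bar>r $ j\<bar> \<le> x powr \<tau>" "\<And>i. i \<in> \<B> \<Longrightarrow> 0 \<le> \<mu> $ i" "\<And>i. i \<notin> \<B> \<Longrightarrow> \<mu> $ i = 0"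
        using that unfolding id0_feasible_def act Let_def x_def[symmetric] r_def[symmetric]
        by (auto simp: abs_le_iff minus_le_iff)
      have "norm r \<le> (\<Sum>j\<in>UNIV. \<bar>r $ j\<bar>)"
        by (rule norm_le_l1_cart)
      also have "\<dots> \<le> n * x powr \<tau>"
        unfolding n_def using feas(1) by (intro sum_bounded_above) auto
      finally have r: "norm r \<le> n * x powr \<tau>" .
      moreover have "0 \<le> (1 + N) * x"
        using N x by simp
      ultimately have "norm r \<le> 1"
        using e(9) by linarith
      then have *: "(\<Sum>j\<in>\<B>. \<mu> $ j) \<le> C" "\<And>i. i \<in> \<B>0 \<Longrightarrow> \<mu> $ i \<le> C * (norm r + d)"
        using e(6)[rule_format, of "($) \<mu>"] feas(2) by (auto simp: r_def)
      show "(\<Sum>j\<in>\<B>. \<mu> $ j) \<le> C"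
        by (rule *)
      show "\<mu> $ i < x powr \<tau>h" if "i \<in> \<B>0" "0 < x"
      proof -
        have "C * (norm r + d) \<le> C * (n * x powr \<tau> + (1 + N + E) * x)"
          using r d(2) mult_nonneg_nonneg[OF N x] x C(1)
          by (intro mult_left_mono) (auto simp: distrib_right)
        also have "\<dots> < x powr \<tau>h"
        proof -
          have "2 * (C * (n * x powr \<tau>)) < x powr \<tau>h" "2 * (C * ((1 + N + E) * x)) < x powr \<tau>h"
            using e(12,13) that(2) by (simp_all add: mult.assoc)
          then show ?thesis
            by (subst distrib_left) linarith
        qed
        finally show ?thesis
          using *(2)[OF that(1)] by linarith
      qed
      show "0 \<le> \<mu> $ j"
        using feas(2,3)[of j] by (cases "j \<in> \<B>") auto
      show "j \<notin> \<B> \<Longrightarrow> \<mu> $ j = 0"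
        by (rule feas)
    qed

    \<comment> \<open>An exact multiplier violates stationarity at \<open>z\<close> only through the
      change of the gradients, which \<open>thr\<close> bounds by the tolerance.\<close>
    have mult_feas: "id0_feasible \<phi> g \<tau> z lam ls" if "ls \<in> \<Lambda>" for ls
    proof -
      have ls: "\<And>i. 0 \<le> ls $ i" "\<And>i. i \<notin> \<B> \<Longrightarrow> ls $ i = 0"
        "grad \<phi> zs + (\<Sum>i\<in>\<B>. ls $ i *\<^sub>R a i zs) = 0"
        using that multiplier_iff by auto
      define r where "r = grad \<phi> z + (\<Sum>i\<in>\<B>. ls $ i *\<^sub>R a i z)"
      have "r = r - (grad \<phi> zs + (\<Sum>i\<in>\<B>. ls $ i *\<^sub>R a i zs))"
        by (simp add: ls(3))
      also have "\<dots> = (grad \<phi> z - grad \<phi> zs) + (\<Sum>i\<in>\<B>. ls $ i *\<^sub>R (a i z - a i zs))"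
        by (simp add: r_def scaleR_diff_right sum_subtractf)
      also have "norm \<dots> \<le> K * d + (\<Sum>i\<in>\<B>. M * (K * d))"
      proof (rule norm_triangle_mono)
        show "norm (grad \<phi> z - grad \<phi> zs) \<le> K * d"
          by (rule e(4))
        show "norm (\<Sum>i\<in>\<B>. ls $ i *\<^sub>R (a i z - a i zs)) \<le> (\<Sum>i\<in>\<B>. M * (K * d))"
          using az M by (intro sum_norm_le) (simp add: mult_mono that)
      qed
      also have "\<dots> \<le> K * d + m * (M * (K * d))"
        using M(1) K(1) d(1) by (simp add: m_def mult_right_mono card_mono)
      also have "\<dots> = K * (1 + m * M) * d"
        by (simp add: algebra_simps)
      finally have "norm r \<le> x powr \<tau>"
        using thr by linarith
      then have "\<bar>r $ j\<bar> \<le> x powr \<tau>" for j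
        using component_le_norm_cart order_trans by blast
      then have "- (x powr \<tau>) \<le> r $ j \<and> r $ j \<le> x powr \<tau>" for j
        by (simp add: abs_le_iff minus_le_iff)
      then show ?thesis
        using ls unfolding id0_feasible_def act Let_def x_def[symmetric] r_def[symmetric] by auto
    qed

    have lam_small: "lam $ i < x powr \<tau>h" if "i \<in> \<B>0" "0 < x" for i
    proof -
      \<comment> \<open>\<open>lam\<close> may have negative entries or nonzero inactive ones. This
        truncation satisfies the sign and support conditions and, by the complementarity part of the
        residual, differs from \<open>lam\<close> by at most \<open>x\<close> in each entry.\<close>
      define \<mu> where "\<mu> j = (if j \<in> \<B> then max 0 (lam $ j) else 0)" for j
      have cmp: "\<bar>min (lam $ j) (- g z $ j)\<bar> \<le> x" for j
        unfolding x_def by (rule compl_le_residual)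
      have "\<bar>\<mu> j - lam $ j\<bar> \<le> x" for j
      proof (cases "j \<in> \<B>")
        case True
        with cmp[of j] show ?thesis by (auto simp: \<mu>_def max_def min_def split: if_splits)
      next
        case False
        have "x < - g z $ j"
          using \<gamma>(2)[OF False] gz[of j] e(1) e(8) powr_ge_zero[of x \<tau>] by linarith
        with cmp[of j] False show ?thesis by (auto simp: \<mu>_def min_def split: if_splits)
      qed
      then have diff: "norm ((\<mu> j - lam $ j) *\<^sub>R a j z) \<le> x * (norm (a j zs) + 1)" for j
      proof -
        have "norm (a j z) \<le> norm (a j zs) + 1"
          using az[of j] e(1) norm_triangle_sub[of "a j z" "a j zs"] by linarith
        with \<open>\<And>j. \<bar>\<mu> j - lam $ j\<bar> \<le> x\<close> x show ?thesis
          by (simp add: mult_mono)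
      qed
      have "(\<Sum>j\<in>\<B>. \<mu> j *\<^sub>R a j z) = (\<Sum>j\<in>UNIV. \<mu> j *\<^sub>R a j z)"
        by (intro sum.mono_neutral_left) (auto simp: \<mu>_def)
      then have "grad \<phi> z + (\<Sum>j\<in>\<B>. \<mu> j *\<^sub>R a j z) =
          lagr_z \<phi> g z lam + (\<Sum>j\<in>UNIV. (\<mu> j - lam $ j) *\<^sub>R a j z)"
        by (simp add: lagr scaleR_diff_left sum_subtractf)
      also have "norm \<dots> \<le> x + (\<Sum>j\<in>UNIV. x * (norm (a j zs) + 1))"
        unfolding x_def
        by (intro norm_triangle_mono lagr_z_le_residual sum_norm_le diff[unfolded x_def])
      also have "\<dots> = (1 + N) * x"
        by (simp add: distrib_right flip: sum_distrib_left N_def)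
      finally have r: "norm (grad \<phi> z + (\<Sum>j\<in>\<B>. \<mu> j *\<^sub>R a j z)) \<le> (1 + N) * x" .
      also have "\<dots> \<le> 1"
      proof -
        have "0 \<le> n * x powr \<tau>"
          by (simp add: n_def)
        with e(9) show ?thesis by linarith
      qed
      finally have "\<mu> i \<le> C * (norm (grad \<phi> z + (\<Sum>j\<in>\<B>. \<mu> j *\<^sub>R a j z)) + d)"
        using e(6)[rule_format, of \<mu>] that(1) by (auto simp: \<mu>_def)
      also have "\<dots> \<le> C * (1 + N + E) * x"
      proof -
        have "C * (norm (grad \<phi> z + (\<Sum>j\<in>\<B>. \<mu> j *\<^sub>R a j z)) + d) \<le> C * ((1 + N + E) * x)"
          using r d(2) C(1) by (intro mult_left_mono) (auto simp: distrib_right)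
        then show ?thesis by (simp only: mult.assoc)
      qed
      also have "\<dots> < x powr \<tau>h"
      proof -
        have "0 \<le> C * (1 + N + E) * x"
          using C(1) N E(1) x by simp
        with e(13) that(2) show ?thesis by simp
      qed
      finally show ?thesis
        using that(1) by (auto simp: \<mu>_def weakly_active_def)
    qed

    have solv: "\<exists>\<mu>. id0_lp_solution \<phi> g \<tau> z lam Ah \<mu>" for Ah
    proof -
      obtain ls where "ls \<in> \<Lambda>"
        using multipliers_nonempty by blast
      moreover have "bounded {\<mu>. id0_feasible \<phi> g \<tau> z lam \<mu>}"
        unfolding bounded_iff
      proof (intro exI[of _ C] ballI)
        fix \<mu> assume "\<mu> \<in> {\<mu>. id0_feasible \<phi> g \<tau> z lam \<mu>}"
        then have \<mu>: "id0_feasible \<phi> g \<tau> z lam \<mu>"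
          by simp
        have "norm \<mu> \<le> (\<Sum>j\<in>UNIV. \<bar>\<mu> $ j\<bar>)"
          by (rule norm_le_l1_cart)
        also have "\<dots> = (\<Sum>j\<in>\<B>. \<mu> $ j)"
          using feas_bound(3,4)[OF \<mu>] by (intro sum.mono_neutral_cong_right) auto
        also have "\<dots> \<le> C"
          by (rule feas_bound(1)[OF \<mu>])
        finally show "norm \<mu> \<le> C" .
      qed
      ultimately show ?thesis
        using mult_feas id0_lp_solution_exists by metis
    qed
    \<comment> \<open>The optimal value is at least \<open>c\<close>, whereas entries all below the
      threshold would sum to less than \<open>c\<close> by \<open>s3\<close>.\<close>
    have strong: "id0_large \<phi> g \<tau>h z lam Ah \<mu> \<noteq> {}"
      if sol: "id0_lp_solution \<phi> g \<tau> z lam Ah \<mu>" and ne: "Ah \<inter> \<B>p \<noteq> {}" for Ah \<mu>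
    proof
      assume "id0_large \<phi> g \<tau>h z lam Ah \<mu> = {}"
      then have lt: "\<And>j. j \<in> Ah \<Longrightarrow> \<mu> $ j \<le> x powr \<tau>h"
        unfolding id0_large_def x_def by fastforce
      obtain i where i: "i \<in> Ah" "i \<in> \<B>p"
        using ne by blast
      obtain ls where ls: "ls \<in> \<Lambda>" "c \<le> ls $ i"
        using c(2)[OF i(2)] by blast
      have "ls $ i \<le> (\<Sum>j\<in>Ah. ls $ j)"
        using ls(1) multiplier_iff i(1) by (intro member_le_sum) auto
      also have "\<dots> \<le> (\<Sum>j\<in>Ah. \<mu> $ j)"
        using sol mult_feas[OF ls(1)] unfolding id0_lp_solution_def by blast
      also have "\<dots> \<le> of_nat (card Ah) * x powr \<tau>h"
        using lt by (rule sum_bounded_above)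
      also have "\<dots> \<le> m * x powr \<tau>h"
        by (simp add: m_def mult_right_mono card_mono)
      finally show False
        using e(10) ls(2) by linarith
    qed
    show ?case
      unfolding z_def[symmetric] lam_def[symmetric]
    proof
      assume off: "p \<notin> kkt_set \<phi> g zs \<or> \<B>0 = {}"
      \<comment> \<open>A zero residual would put the point into the solution set, which
        \<open>off\<close> permits only if there are no weakly active indices.\<close>
      have x_pos: "0 < x" if "i \<in> \<B>0" for i
      proof (rule ccontr)
        assume "\<not> 0 < x"
        with x d have "x = 0" "z = zs"
          by (auto simp: d_def)
        then have "(z, lam) \<in> kkt_set \<phi> g zs"
          using kkt_set_if_residual_0[of lam] by (simp add: x_def)
        with off that show False
          by (auto simp: z_def lam_def)
      qed
      show "id0_terminates_with \<phi> g \<tau>h \<tau> z lam \<B>0 \<B>p"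
      proof (rule id0_terminates_withI)
        show "active_est \<phi> g \<tau> z lam = \<B>p \<union> \<B>0" "\<B>p \<inter> \<B>0 = {}"
          unfolding act by (auto simp: weakly_active_def strongly_active_def)
        show "\<B>0 \<subseteq> id0_init \<phi> g \<tau>h \<tau> z lam"
          unfolding id0_init_def act x_def[symmetric]
          using lam_small x_pos by (force simp: weakly_active_def not_le)
        show "id0_large \<phi> g \<tau>h z lam Ah \<mu> \<inter> \<B>0 = {}" if "id0_lp_solution \<phi> g \<tau> z lam Ah \<mu>" for Ah \<mu>
          using feas_bound(2)[of \<mu>] that x_pos
          unfolding id0_lp_solution_def id0_large_def x_def[symmetric] by fastforce
      qed (use solv strong in auto)
    qed
  qed
qed

end

theorem theorem4:
  fixes \<phi> :: "real^'n \<Rightarrow> real" and g :: "real^'n \<Rightarrow> real^'m" and zs :: "real^'n"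
    and \<tau>h \<tau> :: real
  assumes "standing_assumptions \<phi> g zs"
    and "0 < \<tau>h" and "\<tau>h < \<tau>" and "\<tau> < 1"
  shows "\<exists>\<delta>2>0. \<forall>z lam.
           kkt_dist \<phi> g zs z lam \<le> \<delta>2 \<and>
           ((z, lam) \<notin> kkt_set \<phi> g zs \<or> weakly_active \<phi> g zs = {}) \<longrightarrow>
           id0_terminates_with \<phi> g \<tau>h \<tau> z lam (weakly_active \<phi> g zs) (strongly_active \<phi> g zs)"
proof -
  interpret regular_kkt_point \<phi> g zs
    by unfold_locales (rule assms(1))
  show ?thesis
    using eventually_id0_identifies[OF assms(2-4)] unfolding eventually_near_iff by auto
qed

end
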